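(* Work on $\mathbb{R}^d$ with coordinates $x^\mu$ and smooth fields (non-singular at $x=0$). The map $e\mapsto g$, $g_{\mu\nu}=e^a_\mu e^a_\nu$, is a bijection from the space of vielbeins $e^a=e^a_\mu dx^\mu$ satisfying $$x^\mu e^a_\mu(x)=x^a,\qquad x^a e^a_\mu(x)=x^\mu,\qquad i_a\mathcal L_{\mathfrak r}e^b=i_b\mathcal L_{\mathfrak r}e^a$$ onto the space of Riemannian metrics in normal coordinates, i.e. metrics with $x^\mu g_{\mu\nu}(x)=x^\nu$. Its inverse sends $g$ to the unique solution $e^a_\mu$ of $$\frac{d}{dt}e^a_\mu(tx)=\tfrac12\,e_a^{\ \nu}(tx)\,\frac{d}{dt}g_{\nu\mu}(tx),\qquad e^a_\mu(0)=\delta^a_\mu .$$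
   Context: Latin indices $a,b\in\{1,\dots,d\}$ are frame indices, Greek indices coordinate indices; frame indices are raised/lowered with $\delta_{ab}$ (Euclidean signature), repeated indices summed, and $x^a=\delta^a_\mu x^\mu$. A vielbein is a coframe $e^a=e^a_\mu dx^\mu$ (invertible matrix $e^a_\mu$); its dual vector fields are $e_a=e_a^{\ \mu}\partial_\mu$ with $e^a_\mu e_a^{\ \nu}=\delta^\nu_\mu$, and $i_a$ is the interior product with $e_a$. $\mathfrak r=x^\mu\partial_\mu$ is the radial vector field and $\mathcal L_{\mathfrak r}$ the Lie derivative along it (on a 1-form, $(\mathcal L_{\mathfrak r}\sigma)_\mu=(x^\nu\partial_\nu+1)\sigma_\mu$). *)

theory Defs
  imports "HOL-Analysis.Analysis"
begin

coinductive smooth_fun :: "(real^'n \<Rightarrow> real) \<Rightarrow> bool" where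
  "\<lbrakk> \<forall>x. f differentiable (at x);
     \<forall>i. smooth_fun (\<lambda>x. frechet_derivative f (at x) (axis i 1)) \<rbrakk> \<Longrightarrow> smooth_fun f"

definition smooth_matrix_field :: "(real^'n \<Rightarrow> real^'n^'n) \<Rightarrow> bool" where
  "smooth_matrix_field E \<longleftrightarrow> (\<forall>a m. smooth_fun (\<lambda>x. E x $ a $ m))"

definition mat_inverse :: "real^'n^'n \<Rightarrow> real^'n^'n" where
  "mat_inverse A = (SOME B. A ** B = mat 1 \<and> B ** A = mat 1)"

text \<open>A vielbein: e x \$ a \$ mu = e^a_mu(x), smooth and invertible everywhere.\<close>
definition vielbein :: "(real^'n \<Rightarrow> real^'n^'n) \<Rightarrow> bool" where
  "vielbein e \<longleftrightarrow> smooth_matrix_field e \<and> (\<forall>x. invertible (e x))"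

text \<open>Dual frame components: dual_frame e x \$ nu \$ a = e_a^nu(x).\<close>
definition dual_frame :: "(real^'n \<Rightarrow> real^'n^'n) \<Rightarrow> real^'n \<Rightarrow> real^'n^'n" where
  "dual_frame e x = mat_inverse (e x)"

text \<open>Components of the Lie derivative along r = x^nu d_nu of the 1-form e^b:
  (L_r e^b)_mu (x) = x^nu d_nu e^b_mu (x) + e^b_mu (x).\<close>
definition lie_radial :: "(real^'n \<Rightarrow> real^'n^'n) \<Rightarrow> real^'n \<Rightarrow> 'n \<Rightarrow> 'n \<Rightarrow> real" where
  "lie_radial e x b m = frechet_derivative (\<lambda>y. e y $ b $ m) (at x) x + e x $ b $ m"

definition interior_lie :: "(real^'n \<Rightarrow> real^'n^'n) \<Rightarrow> real^'n \<Rightarrow> 'n \<Rightarrow> 'n \<Rightarrow> real" where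
  "interior_lie e x a b = (\<Sum>m\<in>UNIV. dual_frame e x $ m $ a * lie_radial e x b m)"

definition normal_vielbein :: "(real^'n \<Rightarrow> real^'n^'n) \<Rightarrow> bool" where
  "normal_vielbein e \<longleftrightarrow> vielbein e
     \<and> (\<forall>x. e x *v x = x)
     \<and> (\<forall>x. x v* e x = x)
     \<and> (\<forall>x a b. interior_lie e x a b = interior_lie e x b a)"

definition riemannian_metric :: "(real^'n \<Rightarrow> real^'n^'n) \<Rightarrow> bool" where
  "riemannian_metric g \<longleftrightarrow> smooth_matrix_field g
     \<and> (\<forall>x. transpose (g x) = g x)
     \<and> (\<forall>x v. v \<noteq> 0 \<longrightarrow> v \<bullet> (g x *v v) > 0)"

definition normal_metric :: "(real^'n \<Rightarrow> real^'n^'n) \<Rightarrow> bool" where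
  "normal_metric g \<longleftrightarrow> riemannian_metric g \<and> (\<forall>x. x v* g x = x)"

definition metric_of :: "(real^'n \<Rightarrow> real^'n^'n) \<Rightarrow> real^'n \<Rightarrow> real^'n^'n" where
  "metric_of e = (\<lambda>x. transpose (e x) ** e x)"

definition radial_ode_solution :: "(real^'n \<Rightarrow> real^'n^'n) \<Rightarrow> (real^'n \<Rightarrow> real^'n^'n) \<Rightarrow> bool" where
  "radial_ode_solution g e \<longleftrightarrow> e 0 = mat 1 \<and>
     (\<forall>x t a m. ((\<lambda>s. e (s *\<^sub>R x) $ a $ m) has_real_derivative
        (1/2) * (\<Sum>n\<in>UNIV. dual_frame e (t *\<^sub>R x) $ n $ a
                     * deriv (\<lambda>s. g (s *\<^sub>R x) $ n $ m) t)) (at t))"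

end

theory Submission
  imports Defs
begin

text \<open>
  Write \<open>'\<close> for the derivative along a ray \<open>t \<mapsto> t x\<close>. The symmetry of \<open>i\<^sub>a L\<^sub>r e\<^sup>b\<close> says that
  \<open>e' e\<^sup>-\<^sup>1\<close> is symmetric, which is the same as \<open>2 e' = e\<^sup>-\<^sup>T g'\<close> for \<open>g = e\<^sup>T e\<close>. Conversely this
  equation forces \<open>(e\<^sup>T e)' = g'\<close>, hence \<open>e\<^sup>T e = g\<close> and \<open>e\<^sup>-\<^sup>T = e g\<^sup>-\<^sup>1\<close>: the apparently nonlinear radial
  equation is the linear one \<open>e' = e (g\<^sup>-\<^sup>1 g' / 2)\<close>. For any two of its solutions \<open>e, f\<close> with value 1 at
  the origin, \<open>e g\<^sup>-\<^sup>1 f\<^sup>T\<close> is constant along rays, hence 1; for \<open>f = e\<close> this gives \<open>e\<^sup>T e = g\<close>, and in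
  general it gives uniqueness.

  A solution that is smooth across the origin is found from the Volterra equation
  \<open>u(x) = b(x) + \<Sum>\<nu>. x\<^sub>\<nu> \<integral>\<^sub>0\<^sup>1 t\<^sup>j u(tx) c\<^sub>\<nu>(tx) dt\<close> with \<open>j = 0\<close> and constant \<open>b\<close>. The partial derivatives of a
  solution solve an equation of the same shape with \<open>j + 1\<close> instead of \<open>j\<close> and a right-hand side which is
  as regular as \<open>u\<close> itself, so smoothness follows by induction on the order of differentiability.
\<close>

section \<open>Functions of class \<open>C\<^sup>k\<close>\<close>

definition pd :: "'n \<Rightarrow> (real^'n \<Rightarrow> real) \<Rightarrow> real^'n \<Rightarrow> real" where
  "pd i f x = frechet_derivative f (at x) (axis i 1)"

text \<open>Differentiability is demanded separately because \<open>pd\<close> takes an unspecified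
  value where no Frechet derivative exists. Recursion on the partial derivatives mirrors the rule of
  \<open>smooth_fun\<close>, but with a finite depth on which one can induct.\<close>

fun Ck :: "nat \<Rightarrow> (real^'n \<Rightarrow> real) \<Rightarrow> bool" where
  "Ck 0 f \<longleftrightarrow> continuous_on UNIV f"
| "Ck (Suc k) f \<longleftrightarrow> (\<forall>x. f differentiable (at x)) \<and> (\<forall>i. Ck k (pd i f))"

lemma Ck_1_iff: "Ck 1 f \<longleftrightarrow> (\<forall>x. f differentiable (at x)) \<and> (\<forall>i. continuous_on UNIV (pd i f))"
  by (simp add: One_nat_def)

lemma pd_eqI: "(f has_derivative f') (at x) \<Longrightarrow> pd i f x = f' (axis i 1)"
  unfolding pd_def by (metis frechet_derivative_at)

text \<open>A linear map is determined by its values on the standard basis. This coordinate form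
  feeds both the chain rule along rays and differentiation under the integral.\<close>

lemma has_derivative_pd:
  fixes f :: "real^'n \<Rightarrow> real"
  assumes "f differentiable (at x)"
  shows "(f has_derivative (\<lambda>h. \<Sum>i\<in>UNIV. h $ i * pd i f x)) (at x)"
proof -
  let ?D = "frechet_derivative f (at x)"
  have D: "(f has_derivative ?D) (at x)"
    using assms frechet_derivative_works by blast
  then have lin: "linear ?D"
    using has_derivative_linear by blast
  have "?D h = (\<Sum>i\<in>UNIV. h $ i * pd i f x)" for h
  proof -
    have "?D h = ?D (\<Sum>i\<in>UNIV. h $ i *\<^sub>R axis i 1)"
      using basis_expansion[of h] by (simp add: scalar_mult_eq_scaleR)
    also have "\<dots> = (\<Sum>i\<in>UNIV. h $ i * pd i f x)"
      by (simp add: linear_sum[OF lin] linear_cmul[OF lin] pd_def)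
    finally show ?thesis .
  qed
  then have "?D = (\<lambda>h. \<Sum>i\<in>UNIV. h $ i * pd i f x)" by blast
  with D show ?thesis by simp
qed

lemma has_real_derivative_ray:
  fixes f :: "real^'n \<Rightarrow> real"
  assumes "f differentiable (at (t *\<^sub>R y))"
  shows "((\<lambda>t. f (t *\<^sub>R y)) has_real_derivative (\<Sum>i\<in>UNIV. y $ i * pd i f (t *\<^sub>R y))) (at t within S)"
proof -
  have "((\<lambda>t. f (t *\<^sub>R y)) has_derivative (\<lambda>h. \<Sum>i\<in>UNIV. (h *\<^sub>R y) $ i * pd i f (t *\<^sub>R y))) (at t within S)"
    by (rule has_derivative_compose[where f = "\<lambda>t. t *\<^sub>R y", OF _ has_derivative_pd[OF assms]])
      (auto intro!: derivative_eq_intros)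
  then show ?thesis
    unfolding has_field_derivative_def
    by (rule has_derivative_eq_rhs) (simp add: fun_eq_iff sum_distrib_left sum_distrib_right mult_ac)
qed

lemma differentiable_imp_continuous_UNIV:
  fixes f :: "real^'n \<Rightarrow> real"
  shows "\<forall>x. f differentiable (at x) \<Longrightarrow> continuous_on UNIV f"
  by (simp add: continuous_at_imp_continuous_on differentiable_imp_continuous_within)

lemma Ck_continuous: "Ck k f \<Longrightarrow> continuous_on UNIV f"
  by (cases k) (auto intro: differentiable_imp_continuous_UNIV)

lemma Ck_1D:
  assumes "Ck 1 f"
  shows "f differentiable (at x)" "continuous_on UNIV f" "continuous_on UNIV (pd i f)"
  using assms Ck_continuous[of 1 f] by (auto simp: Ck_1_iff)

lemma Ck_SucD: "Ck (Suc k) f \<Longrightarrow> Ck k f"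
proof (induction k arbitrary: f)
  case 0
  then show ?case by (auto intro: differentiable_imp_continuous_UNIV)
next
  case (Suc k)
  then show ?case by (metis Ck.simps(2))
qed

section \<open>Smoothness as membership in every class C^k\<close>

lemma smooth_fun_pd: "smooth_fun f \<Longrightarrow> smooth_fun (pd i f)"
  unfolding pd_def[abs_def] by (cases f rule: smooth_fun.cases) auto

lemma smooth_fun_differentiable: "smooth_fun f \<Longrightarrow> f differentiable (at x)"
  by (cases f rule: smooth_fun.cases) auto

lemma smooth_fun_imp_Ck: "smooth_fun f \<Longrightarrow> Ck k f"
proof (induction k arbitrary: f)
  case 0
  then show ?case
    by (auto intro: differentiable_imp_continuous_UNIV smooth_fun_differentiable)
next
  case (Suc k)
  then show ?case by (auto intro: smooth_fun_differentiable smooth_fun_pd)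
qed

text \<open>The functions lying in all classes \<open>Ck k\<close> are closed under the rule of
  \<open>smooth_fun\<close>, so coinduction puts them into it. Smoothness can thus be proved by
  induction on the order.\<close>

lemma smooth_fun_iff_Ck: "smooth_fun f \<longleftrightarrow> (\<forall>k. Ck k f)"
proof
  assume "\<forall>k. Ck k f"
  then show "smooth_fun f"
  proof (coinduction arbitrary: f)
    case smooth_fun
    then have *: "Ck (Suc k) f" for k by blast
    then have "Ck k (\<lambda>x. frechet_derivative f (at x) (axis i 1))" for i k
      unfolding pd_def[symmetric] by simp
    moreover have "\<forall>x. f differentiable (at x)" using *[of 0] by simp
    ultimately show ?case by blast
  qed
qed (auto intro: smooth_fun_imp_Ck)

section \<open>Closure of C^k under algebraic operations\<close>

lemma Ck_const [simp]: "Ck k (\<lambda>x::real^'n. c)"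
proof (induction k arbitrary: c)
  case (Suc k)
  have "pd i (\<lambda>x. c) = (\<lambda>x. 0)" for i :: 'n
    by (intro ext, rule pd_eqI[where f'="\<lambda>h. 0"]) auto
  with Suc show ?case by simp
qed simp

lemma pd_add:
  assumes "f differentiable (at x)" "g differentiable (at x)"
  shows "pd i (\<lambda>x. f x + g x) x = pd i f x + pd i g x"
  unfolding pd_def
  by (metis assms frechet_derivative_at frechet_derivative_works has_derivative_add)

lemma pd_mult:
  fixes f g :: "real^'n \<Rightarrow> real"
  assumes "f differentiable (at x)" "g differentiable (at x)"
  shows "pd i (\<lambda>x. f x * g x) x = pd i f x * g x + f x * pd i g x"
proof -
  have "pd i (\<lambda>x. f x * g x) x =
      f x * frechet_derivative g (at x) (axis i 1) + frechet_derivative f (at x) (axis i 1) * g x"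
    by (rule pd_eqI[OF has_derivative_mult]) (use assms frechet_derivative_works in blast)+
  then show ?thesis by (simp add: pd_def)
qed

lemma Ck_add: "Ck k f \<Longrightarrow> Ck k g \<Longrightarrow> Ck k (\<lambda>x. f x + g x)"
proof (induction k arbitrary: f g)
  case (Suc k)
  then have "pd i (\<lambda>x. f x + g x) = (\<lambda>x. pd i f x + pd i g x)" for i
    by (intro ext pd_add) auto
  with Suc show ?case by auto
qed (auto intro: continuous_intros)

lemma Ck_sum: "(\<And>a. a \<in> S \<Longrightarrow> Ck k (f a)) \<Longrightarrow> Ck k (\<lambda>x. \<Sum>a\<in>S. f a x)"
  by (induction S rule: infinite_finite_induct) (auto intro: Ck_add)

lemma Ck_mult: "Ck k f \<Longrightarrow> Ck k g \<Longrightarrow> Ck k (\<lambda>x. f x * g x)"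
proof (induction k arbitrary: f g)
  case (Suc k)
  then have "pd i (\<lambda>x. f x * g x) = (\<lambda>x. pd i f x * g x + f x * pd i g x)" for i
    by (intro ext pd_mult) auto
  moreover have "Ck k (\<lambda>x. pd i f x * g x + f x * pd i g x)" for i
    using Suc.prems Ck_SucD by (intro Ck_add Suc.IH) auto
  ultimately show ?case using Suc.prems by auto
qed (auto intro: continuous_intros)

lemma Ck_prod: "(\<And>a. a \<in> S \<Longrightarrow> Ck k (f a)) \<Longrightarrow> Ck k (\<lambda>x. \<Prod>a\<in>S. f a x)"
  by (induction S rule: infinite_finite_induct) (auto intro: Ck_mult)

text \<open>The sign is written as a factor \<open>- 1\<close> so that the right-hand side consists
  of products only, to which \<open>Ck_mult\<close> and \<open>Ck_const\<close> apply.\<close>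

lemma pd_inverse:
  fixes f :: "real^'n \<Rightarrow> real"
  assumes "f differentiable (at x)" "f x \<noteq> 0"
  shows "pd i (\<lambda>x. inverse (f x)) x = - 1 * (inverse (f x) * (pd i f x * inverse (f x)))"
proof -
  have "pd i (\<lambda>x. inverse (f x)) x = - (inverse (f x) * frechet_derivative f (at x) (axis i 1) * inverse (f x))"
    by (rule pd_eqI[OF Deriv.has_derivative_inverse]) (use assms frechet_derivative_works in blast)+
  then show ?thesis by (simp add: pd_def)
qed

lemma Ck_inverse: "Ck k f \<Longrightarrow> (\<And>x. f x \<noteq> 0) \<Longrightarrow> Ck k (\<lambda>x. inverse (f x))"
proof (induction k arbitrary: f)
  case (Suc k)
  then have "pd i (\<lambda>x. inverse (f x)) = (\<lambda>x. - 1 * (inverse (f x) * (pd i f x * inverse (f x))))" for i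
    by (intro ext pd_inverse) auto
  \<comment> \<open>The reciprocal reappears in its own derivative, but only to order
    \<open>k\<close>, which the induction hypothesis supplies.\<close>
  moreover have "Ck k (\<lambda>x. - 1 * (inverse (f x) * (pd i f x * inverse (f x))))" for i
    using Suc.prems Ck_SucD by (intro Ck_mult Suc.IH Ck_const) auto
  moreover have "(\<lambda>x. inverse (f x)) differentiable (at x)" for x
    using Suc.prems by (auto intro!: differentiable_inverse)
  ultimately show ?case by auto
qed (auto intro: continuous_intros)

lemma pd_nth: "pd i (\<lambda>x. x $ j) x = (if i = j then 1 else 0)"
proof -
  have "pd i (\<lambda>x. x $ j) x = axis i 1 $ j"
    by (rule pd_eqI) (intro bounded_linear_imp_has_derivative bounded_linear_vec_nth)
  then show ?thesis by (simp add: axis_def)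
qed

lemma differentiable_nth: "(\<lambda>x::real^'n. x $ j) differentiable (at x)"
  using bounded_linear_imp_has_derivative[OF bounded_linear_vec_nth] differentiable_def by blast

lemma Ck_nth [simp]: "Ck k (\<lambda>x. x $ j)"
proof (cases k)
  case (Suc k')
  have "pd i (\<lambda>x. x $ j) = (\<lambda>x. if i = j then 1 else 0)" for i
    by (intro ext pd_nth)
  with Suc show ?thesis by (simp add: differentiable_nth)
qed (auto intro: continuous_intros)

section \<open>Weighted means along rays\<close>

text \<open>The exponent \<open>j\<close> counts differentiations: the chain rule for
  \<open>v (t *\<^sub>R x)\<close> yields one factor t for each derivative in x.\<close>

definition rmean :: "nat \<Rightarrow> (real^'n \<Rightarrow> real) \<Rightarrow> real^'n \<Rightarrow> real" where
  "rmean j v x = integral {0..1} (\<lambda>t. t ^ j * v (t *\<^sub>R x))"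

lemma continuous_ray:
  fixes v :: "real^'n \<Rightarrow> real"
  shows "continuous_on UNIV v \<Longrightarrow> continuous_on S (\<lambda>t. v (t *\<^sub>R x))"
  by (rule continuous_on_compose2[of UNIV v]) (auto intro!: continuous_intros)

lemma rmean_integrable:
  fixes v :: "real^'n \<Rightarrow> real"
  assumes "continuous_on UNIV v"
  shows "(\<lambda>t. t ^ j * v (t *\<^sub>R x)) integrable_on {0..1}"
  by (intro integrable_continuous_real continuous_intros continuous_ray assms)

lemma rmean_continuous:
  fixes v :: "real^'n \<Rightarrow> real"
  assumes "continuous_on UNIV v"
  shows "continuous_on UNIV (rmean j v)"
proof -
  have "continuous_on (UNIV \<times> cbox 0 1) (\<lambda>(x, t). t ^ j * v (t *\<^sub>R x))"
    unfolding split_beta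
    by (intro continuous_intros continuous_on_compose2[OF assms]) auto
  from integral_continuous_on_param[OF this] show ?thesis
    by (simp add: rmean_def[abs_def] cbox_interval)
qed

text \<open>Differentiation under the integral sign; the inner scaling by t raises the weight from
  \<open>j\<close> to \<open>Suc j\<close>.\<close>

lemma rmean_has_derivative:
  fixes v :: "real^'n \<Rightarrow> real"
  assumes "Ck 1 v"
  shows "(rmean j v has_derivative (\<lambda>h. \<Sum>i\<in>UNIV. h $ i * rmean (Suc j) (pd i v) x)) (at x)"
proof -
  have dv: "v differentiable (at x)" and cv: "continuous_on UNIV (pd i v)" for x i
    using assms by (auto simp: Ck_1_iff)
  \<comment> \<open>The Leibniz rule wants the derivative as a continuous map into bounded linear
    functions, so the coordinate functionals are packaged as such.\<close>
  define B where "B i = (blinfun_inner_right (axis i 1) :: (real^'n) \<Rightarrow>\<^sub>L real)" for i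
  have B: "blinfun_apply (B i) h = h $ i" for i h
    by (simp add: B_def inner_axis')
  define fx where "fx x t = (\<Sum>i\<in>UNIV. (t ^ Suc j * pd i v (t *\<^sub>R x)) *\<^sub>R B i)" for x t
  have "((\<lambda>x. integral (cbox 0 1) (\<lambda>t. t ^ j * v (t *\<^sub>R x))) has_derivative
      blinfun_apply (integral (cbox 0 1) (fx x))) (at x within UNIV)"
  proof (rule leibniz_rule)
    fix x :: "real^'n" and t :: real
    have "((\<lambda>x. v (t *\<^sub>R x)) has_derivative (\<lambda>h. \<Sum>i\<in>UNIV. (t *\<^sub>R h) $ i * pd i v (t *\<^sub>R x))) (at x)"
      by (rule has_derivative_compose[OF _ has_derivative_pd[OF dv]])
        (auto intro!: derivative_eq_intros)
    then have "((\<lambda>x. t ^ j * v (t *\<^sub>R x)) has_derivative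
        (\<lambda>h. t ^ j * (\<Sum>i\<in>UNIV. (t *\<^sub>R h) $ i * pd i v (t *\<^sub>R x)))) (at x)"
      by (rule has_derivative_mult_right)
    also have "(\<lambda>h. t ^ j * (\<Sum>i\<in>UNIV. (t *\<^sub>R h) $ i * pd i v (t *\<^sub>R x))) = blinfun_apply (fx x t)"
      by (simp add: fx_def blinfun.sum_left blinfun.scaleR_left B sum_distrib_left fun_eq_iff algebra_simps)
    finally show "((\<lambda>x. t ^ j * v (t *\<^sub>R x)) has_derivative blinfun_apply (fx x t)) (at x within UNIV)" .
  next
    show "(\<lambda>t. t ^ j * v (t *\<^sub>R x)) integrable_on cbox 0 1" for x
      using rmean_integrable[of v] dv differentiable_imp_continuous_UNIV[of v] by (simp add: cbox_interval)
    show "continuous_on (UNIV \<times> cbox 0 1) (\<lambda>(x, t). fx x t)"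
      unfolding split_beta fx_def
      by (intro continuous_intros continuous_on_compose2[OF cv]) auto
  qed auto
  also have "integral (cbox 0 1) (fx x) = (\<Sum>i\<in>UNIV. rmean (Suc j) (pd i v) x *\<^sub>R B i)"
  proof -
    have *: "((\<lambda>t. (t ^ Suc j * pd i v (t *\<^sub>R x)) *\<^sub>R B i) has_integral rmean (Suc j) (pd i v) x *\<^sub>R B i) (cbox 0 1)" for i
      unfolding rmean_def cbox_interval
      by (intro has_integral_scaleR_left integrable_integral rmean_integrable cv)
    show ?thesis
      unfolding fx_def by (intro integral_unique has_integral_sum *) auto
  qed
  also have "blinfun_apply \<dots> = (\<lambda>h. \<Sum>i\<in>UNIV. h $ i * rmean (Suc j) (pd i v) x)"
    by (simp add: blinfun.sum_left blinfun.scaleR_left B fun_eq_iff algebra_simps)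
  finally show ?thesis
    by (simp add: rmean_def[abs_def] cbox_interval)
qed

lemma Ck_imp_Ck1: "Ck (Suc k) f \<Longrightarrow> Ck 1 f"
  by (auto dest: Ck_continuous simp: Ck_1_iff)

lemma rmean_differentiable: "Ck 1 v \<Longrightarrow> rmean j v differentiable (at x)"
  using rmean_has_derivative differentiable_def by blast

lemma sum_axis [simp]: "(\<Sum>i\<in>UNIV. axis k 1 $ i * f i) = (f k :: real)"
  by (simp add: axis_def if_distrib[of "\<lambda>x. x * _"] cong: if_cong)

lemma pd_rmean: "Ck 1 v \<Longrightarrow> pd i (rmean j v) x = rmean (Suc j) (pd i v) x"
  by (subst pd_eqI[OF rmean_has_derivative]) simp_all

text \<open>The weight has to vary in the induction, because a partial derivative of a mean is a
  mean with the next weight.\<close>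

lemma Ck_rmean: "Ck k v \<Longrightarrow> Ck k (rmean j v)"
proof (induction k arbitrary: v j)
  case (Suc k)
  then have "Ck 1 v" by (rule_tac Ck_imp_Ck1)
  then have "pd i (rmean j v) = rmean (Suc j) (pd i v)" for i
    by (intro ext pd_rmean)
  with Suc \<open>Ck 1 v\<close> show ?case by (auto intro: rmean_differentiable)
qed (auto intro: rmean_continuous)

lemma rmean_diff:
  fixes v w :: "real^'n \<Rightarrow> real"
  assumes "continuous_on UNIV v" "continuous_on UNIV w"
  shows "rmean j (\<lambda>y. v y - w y) x = rmean j v x - rmean j w x"
  unfolding rmean_def
  by (simp add: right_diff_distrib integral_diff rmean_integrable assms)

lemma rmean_add:
  fixes v w :: "real^'n \<Rightarrow> real"
  assumes "continuous_on UNIV v" "continuous_on UNIV w"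
  shows "rmean j (\<lambda>y. v y + w y) x = rmean j v x + rmean j w x"
  unfolding rmean_def
  by (simp add: distrib_left integral_add rmean_integrable assms)

text \<open>Order-k growth contributes t^k along the ray, and integrating it gives 1/(k+1); the
  weight t^j is estimated by 1. These factors accumulate to the factorial that makes the Picard
  series converge.\<close>

lemma rmean_bound:
  fixes v :: "real^'n \<Rightarrow> real"
  assumes "continuous_on UNIV v" "norm x \<le> R" "\<And>y. norm y \<le> R \<Longrightarrow> \<bar>v y\<bar> \<le> \<beta> * norm y ^ k"
  shows "\<bar>rmean j v x\<bar> \<le> \<beta> * norm x ^ k / (k + 1)"
proof -
  have \<beta>x: "0 \<le> \<beta> * norm x ^ k" using assms(3)[OF assms(2)] by linarith
  have pw: "((\<lambda>t. t ^ k) has_integral (1 / (k + 1))) {0..1::real}"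
  proof -
    have "((\<lambda>t::real. t ^ k) has_integral (1 ^ Suc k / Suc k - 0 ^ Suc k / Suc k)) {0..1}"
      by (rule fundamental_theorem_of_calculus)
        (auto intro!: derivative_eq_intros simp: has_real_derivative_iff_has_vector_derivative[symmetric]
           divide_simps simp del: power_Suc)
    then show ?thesis by (simp add: add.commute)
  qed
  have I: "((\<lambda>t. \<beta> * norm x ^ k * t ^ k) has_integral (\<beta> * norm x ^ k * (1 / (k + 1)))) {0..1}"
    by (rule has_integral_mult_right[OF pw])
  have "norm (integral {0..1} (\<lambda>t. t ^ j * v (t *\<^sub>R x))) \<le> integral {0..1} (\<lambda>t. \<beta> * norm x ^ k * t ^ k)"
  proof (rule integral_norm_bound_integral)
    show "(\<lambda>t. \<beta> * norm x ^ k * t ^ k) integrable_on {0..1}" using I by blast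
    fix t :: real assume t: "t \<in> {0..1}"
    have "norm (t *\<^sub>R x) \<le> R"
      using t assms(2) mult_left_le_one_le[of "norm x" t] by auto
    then have "\<bar>v (t *\<^sub>R x)\<bar> \<le> \<beta> * norm (t *\<^sub>R x) ^ k" by (rule assms(3))
    moreover have "t ^ j \<le> 1" using t by (simp add: power_le_one)
    ultimately show "norm (t ^ j * v (t *\<^sub>R x)) \<le> \<beta> * norm x ^ k * t ^ k"
      using t mult_mono[of "t ^ j" 1 "\<bar>v (t *\<^sub>R x)\<bar>" "\<beta> * norm (t *\<^sub>R x) ^ k"]
      by (simp add: abs_mult power_mult_distrib algebra_simps)
  qed (rule rmean_integrable[OF assms(1)])
  then show ?thesis using integral_unique[OF I] by (simp add: rmean_def)
qed

text \<open>Integrate the derivative of t * f(ty) over the unit interval. It later shows that s *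
  (mean of f at sx) is a primitive of f along the ray.\<close>

lemma rmean_Euler:
  fixes f :: "real^'n \<Rightarrow> real"
  assumes "Ck 1 f"
  shows "rmean 0 f y + (\<Sum>i\<in>UNIV. y $ i * rmean 1 (pd i f) y) = f y"
proof -
  have df: "f differentiable (at x)" and cf: "continuous_on UNIV (pd i f)" for x i
    using assms by (auto simp: Ck_1_iff)
  have cf0: "continuous_on UNIV f" using assms Ck_continuous by blast
  have "((\<lambda>t. t * f (t *\<^sub>R y)) has_vector_derivative
       (f (t *\<^sub>R y) + t * (\<Sum>i\<in>UNIV. y $ i * pd i f (t *\<^sub>R y)))) (at t within S)" for t S
  proof -
    note has_real_derivative_ray[where y = y and t = t and S = S, OF df]
    then show ?thesis
      unfolding has_real_derivative_iff_has_vector_derivative[symmetric]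
      by (auto intro!: derivative_eq_intros)
  qed
  then have "((\<lambda>t. f (t *\<^sub>R y) + t * (\<Sum>i\<in>UNIV. y $ i * pd i f (t *\<^sub>R y))) has_integral
      (1 * f (1 *\<^sub>R y) - 0 * f (0 *\<^sub>R y))) {0..1}"
    by (intro fundamental_theorem_of_calculus) auto
  moreover have "((\<lambda>t. t ^ 0 * f (t *\<^sub>R y) + (\<Sum>i\<in>UNIV. y $ i * (t ^ 1 * pd i f (t *\<^sub>R y)))) has_integral
      rmean 0 f y + (\<Sum>i\<in>UNIV. y $ i * rmean 1 (pd i f) y)) {0..1}"
    unfolding rmean_def
    by (intro has_integral_add has_integral_sum has_integral_mult_right integrable_integral rmean_integrable cf cf0) auto
  ultimately show ?thesis
    by (simp add: has_integral_unique sum_distrib_left mult_ac)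
qed

section \<open>The radial Volterra equation\<close>

text \<open>For \<open>j = 0\<close> this is the line integral, along the segment from the origin to
  x, of the 1-form with components (u c)_\<nu>. The unknown \<open>u\<close> acts as a row vector
  multiplied from the right by the coefficient matrices.\<close>

definition volterra ::
    "('n \<Rightarrow> 'm \<Rightarrow> 'm \<Rightarrow> real^'n \<Rightarrow> real) \<Rightarrow> nat \<Rightarrow> ('m::finite \<Rightarrow> real^'n \<Rightarrow> real) \<Rightarrow> 'm \<Rightarrow> real^'n \<Rightarrow> real" where
  "volterra c j u m x = (\<Sum>\<nu>\<in>UNIV. \<Sum>p\<in>UNIV. x $ \<nu> * rmean j (\<lambda>y. u p y * c \<nu> p m y) x)"

lemma Ck_volterra:
  assumes "\<And>\<nu> p m. Ck k (c \<nu> p m)" "\<And>p. Ck k (u p)"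
  shows "Ck k (volterra c j u m)"
  unfolding volterra_def[abs_def]
  by (intro Ck_sum Ck_mult Ck_rmean assms Ck_nth)

lemma volterra_diff:
  fixes u w :: "'m::finite \<Rightarrow> real^'n \<Rightarrow> real"
  assumes "\<And>\<nu> p m. continuous_on UNIV (c \<nu> p m)" "\<And>p. continuous_on UNIV (u p)" "\<And>p. continuous_on UNIV (w p)"
  shows "volterra c j (\<lambda>p y. u p y - w p y) m x = volterra c j u m x - volterra c j w m x"
  unfolding volterra_def left_diff_distrib
  by (simp add: rmean_diff assms continuous_on_mult sum_subtractf right_diff_distrib)

section \<open>Growth estimates and Picard iteration\<close>

lemma continuous_bounded_cball:
  fixes f :: "'i::finite \<Rightarrow> real^'n \<Rightarrow> real"
  assumes "\<And>i. continuous_on UNIV (f i)"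
  obtains K where "K \<ge> 0" "\<And>i y. norm y \<le> R \<Longrightarrow> \<bar>f i y\<bar> \<le> K"
proof -
  have "\<exists>K. \<forall>y. norm y \<le> R \<longrightarrow> \<bar>f i y\<bar> \<le> K" for i
  proof -
    have "compact (f i ` cball 0 R)"
      by (intro compact_continuous_image continuous_on_subset[OF assms]) auto
    then obtain K where "\<forall>z \<in> f i ` cball 0 R. norm z \<le> K"
      using compact_imp_bounded bounded_iff by blast
    then have "\<forall>y. norm y \<le> R \<longrightarrow> \<bar>f i y\<bar> \<le> K" by simp
    then show ?thesis ..
  qed
  then obtain K where K: "\<And>i y. norm y \<le> R \<Longrightarrow> \<bar>f i y\<bar> \<le> K i"
    by metis
  have "\<bar>f i y\<bar> \<le> (\<Sum>i\<in>UNIV. \<bar>K i\<bar>)" if "norm y \<le> R" for i y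
    using K[OF that, of i] member_le_sum[of i UNIV "\<lambda>i. \<bar>K i\<bar>"] by simp
  then show thesis
    by (intro that[of "\<Sum>i\<in>UNIV. \<bar>K i\<bar>"]) (auto intro: sum_nonneg)
qed

lemma rmean_mult_bound:
  fixes v w :: "real^'n \<Rightarrow> real"
  assumes "continuous_on UNIV v" "continuous_on UNIV w" "norm x \<le> R"
    and "\<And>y. norm y \<le> R \<Longrightarrow> \<bar>v y\<bar> \<le> \<beta> * norm y ^ k" "\<And>y. norm y \<le> R \<Longrightarrow> \<bar>w y\<bar> \<le> K"
  shows "\<bar>rmean j (\<lambda>y. v y * w y) x\<bar> \<le> K * \<beta> * norm x ^ k / (k + 1)"
proof (rule rmean_bound[OF _ assms(3)])
  fix y :: "real^'n" assume "norm y \<le> R"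
  then have "\<bar>v y\<bar> * \<bar>w y\<bar> \<le> (\<beta> * norm y ^ k) * K"
    by (intro mult_mono assms) (auto intro: order_trans[OF abs_ge_zero assms(4)])
  then show "\<bar>v y * w y\<bar> \<le> K * \<beta> * norm y ^ k"
    by (simp add: abs_mult mult_ac)
qed (intro continuous_intros assms)

text \<open>Quantitative vanishing to order k at the origin. Global continuity is bundled in so that
  the predicate passes through \<open>volterra\<close> without side conditions.\<close>

definition has_growth :: "real \<Rightarrow> real \<Rightarrow> nat \<Rightarrow> ('m \<Rightarrow> real^'n \<Rightarrow> real) \<Rightarrow> bool" where
  "has_growth R \<beta> k u \<longleftrightarrow> (\<forall>p. continuous_on UNIV (u p)) \<and> (\<forall>p y. norm y \<le> R \<longrightarrow> \<bar>u p y\<bar> \<le> \<beta> * norm y ^ k)"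

lemma has_growthD:
  assumes "has_growth R \<beta> k u"
  shows "continuous_on UNIV (u p)" "norm y \<le> R \<Longrightarrow> \<bar>u p y\<bar> \<le> \<beta> * norm y ^ k"
  using assms by (auto simp: has_growth_def)

lemma continuous_has_growth_0:
  fixes u :: "'m::finite \<Rightarrow> real^'n \<Rightarrow> real"
  assumes "\<And>p. continuous_on UNIV (u p)"
  obtains \<beta> where "\<beta> \<ge> 0" "has_growth R \<beta> 0 u"
proof -
  obtain \<beta> where "\<beta> \<ge> 0" "\<And>p y. norm y \<le> R \<Longrightarrow> \<bar>u p y\<bar> \<le> \<beta>"
    using continuous_bounded_cball[of u R] assms by metis
  with assms show thesis by (intro that[of \<beta>]) (auto simp: has_growth_def)
qed

text \<open>The prefactor x_\<nu> raises the order by one and the mean supplies the division by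
  \<open>Suc k\<close>. The constant C depends on the ball and on the coefficients, but not on u,
  \<beta> or k, so the estimate can be iterated.\<close>

lemma volterra_growth:
  fixes c :: "'n::finite \<Rightarrow> 'm::finite \<Rightarrow> 'm \<Rightarrow> real^'n \<Rightarrow> real"
  assumes "\<And>\<nu> p m. continuous_on UNIV (c \<nu> p m)"
  obtains C where "C \<ge> 0"
    "\<And>u \<beta> k. has_growth R \<beta> k u \<Longrightarrow> has_growth R (C * \<beta> / Suc k) (Suc k) (volterra c j u)"
proof -
  obtain K where K: "K \<ge> 0" "\<And>\<nu> p m y. norm y \<le> R \<Longrightarrow> \<bar>c \<nu> p m y\<bar> \<le> K"
    using continuous_bounded_cball[of "\<lambda>(\<nu>, p, m). c \<nu> p m" R] assms
    by (simp add: split_beta split_paired_all) metis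
  define C where "C = CARD('n) * CARD('m) * K"
  have "has_growth R (C * \<beta> / Suc k) (Suc k) (volterra c j u)" if u: "has_growth R \<beta> k u" for u \<beta> k
  proof -
    note u = has_growthD[OF u]
    have "\<bar>volterra c j u m x\<bar> \<le> (C * \<beta> / Suc k) * norm x ^ Suc k" if x: "norm x \<le> R" for x m
    proof -
      have "\<bar>volterra c j u m x\<bar> \<le> (\<Sum>\<nu>\<in>UNIV. \<Sum>p\<in>UNIV. \<bar>x $ \<nu> * rmean j (\<lambda>y. u p y * c \<nu> p m y) x\<bar>)"
        unfolding volterra_def by (rule order_trans[OF sum_abs]) (intro sum_mono sum_abs)
      also have "\<dots> \<le> (\<Sum>\<nu>\<in>(UNIV::'n set). \<Sum>p\<in>(UNIV::'m set). norm x * (K * \<beta> * norm x ^ k / (k + 1)))"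
        unfolding abs_mult
        by (intro sum_mono mult_mono component_le_norm_cart
            rmean_mult_bound[OF u(1) assms x u(2) K(2)] norm_ge_zero abs_ge_zero)
      also have "\<dots> = (C * \<beta> / Suc k) * norm x ^ Suc k"
        by (simp add: C_def field_simps)
      finally show ?thesis .
    qed
    moreover have "continuous_on UNIV (volterra c j u m)" for m
      using Ck_volterra[of 0 c u] assms u(1) by simp
    ultimately show ?thesis by (auto simp: has_growth_def)
  qed
  moreover have "C \<ge> 0" using K by (simp add: C_def)
  ultimately show thesis by (rule that[rotated])
qed

text \<open>Starting at zero makes the first iterate equal to \<open>b\<close>, so the successive
  differences are \<open>b\<close> and its images under powers of the Volterra operator.\<close>

primrec picard ::
    "('n \<Rightarrow> 'm \<Rightarrow> 'm \<Rightarrow> real^'n \<Rightarrow> real) \<Rightarrow> nat \<Rightarrow> ('m::finite \<Rightarrow> real^'n \<Rightarrow> real) \<Rightarrow> nat \<Rightarrow> 'm \<Rightarrow> real^'n \<Rightarrow> real" where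
  "picard c j b 0 = (\<lambda>m x. 0)"
| "picard c j b (Suc k) = (\<lambda>m x. b m x + volterra c j (picard c j b k) m x)"

lemma Ck_picard:
  assumes "\<And>\<nu> p m. Ck k (c \<nu> p m)" "\<And>m. Ck k (b m)"
  shows "Ck k (picard c j b i m)"
proof (induction i arbitrary: m)
  case (Suc i)
  then show ?case
    unfolding picard.simps by (intro Ck_add Ck_volterra assms) auto
qed simp

text \<open>The divisors 1, 2, ..., k of the successive steps multiply up to
  \<open>fact k\<close>.\<close>

lemma volterra_iterate_growth:
  assumes C: "\<And>u \<beta> k. has_growth R \<beta> k u \<Longrightarrow> has_growth R (C * \<beta> / Suc k) (Suc k) (volterra c j u)"
    and v: "\<And>k. v (Suc k) = volterra c j (v k)" and \<beta>: "has_growth R \<beta> 0 (v 0)"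
  shows "has_growth R (\<beta> * C ^ k / fact k) k (v k)"
proof (induction k)
  case (Suc k)
  have "C * (\<beta> * C ^ k / fact k) / Suc k = \<beta> * C ^ Suc k / fact (Suc k)"
    by (simp add: field_simps)
  with C[OF Suc] show ?case by (simp only: v)
qed (use \<beta> in simp)

text \<open>Replaces the growth bound by a term of the exponential series that is uniform over the
  ball.\<close>

lemma power_fact_bound:
  assumes "norm x \<le> R" "0 \<le> \<beta>" "0 \<le> (C::real)"
  shows "(\<beta> * C ^ k / fact k) * norm x ^ k \<le> \<beta> * ((C * R) ^ k / fact k)"
proof -
  have "norm x ^ k \<le> R ^ k" using assms by (intro power_mono) auto
  then have "(\<beta> * C ^ k / fact k) * norm x ^ k \<le> (\<beta> * C ^ k / fact k) * R ^ k"
    using assms by (intro mult_left_mono) auto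
  then show ?thesis by (simp add: power_mult_distrib)
qed

lemma summable_power_fact: "summable (\<lambda>k. \<beta> * ((z::real) ^ k / fact k))"
  using summable_exp_generic[of z] by (intro summable_mult) (simp add: divide_inverse mult.commute)

text \<open>The Picard differences are dominated on every ball by an exponential series, so the
  iterates converge locally uniformly to a continuous limit. The operator bound then allows passing
  to the limit in the recursion.\<close>

lemma volterra_solution_exists:
  fixes c :: "'n::finite \<Rightarrow> 'm::finite \<Rightarrow> 'm \<Rightarrow> real^'n \<Rightarrow> real"
  assumes c: "\<And>\<nu> p m. continuous_on UNIV (c \<nu> p m)" and b: "\<And>m. continuous_on UNIV (b m)"
  obtains u where "\<And>m. continuous_on UNIV (u m)" "\<And>m x. u m x = b m x + volterra c j u m x"
proof -
  define w where "w = picard c j b"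
  have cw: "continuous_on UNIV (w k p)" for k p
    using Ck_picard[of 0 c b] c b by (simp add: w_def)
  \<comment> \<open>The increments of the iteration: their partial sums telescope back to
    \<open>w\<close>, and by linearity each is the Volterra image of the preceding one.\<close>
  define v where "v k m x = w (Suc k) m x - w k m x" for k m x
  have cv: "continuous_on UNIV (v k p)" for k p
    unfolding v_def[abs_def] by (intro continuous_intros cw)
  have v0: "v 0 = b"
    by (simp add: v_def w_def volterra_def rmean_def fun_eq_iff)
  have vS: "v (Suc k) m x = volterra c j (v k) m x" for k m x
    unfolding v_def[abs_def] volterra_diff[OF c cw cw] by (simp add: w_def)
  have sum_v: "(\<Sum>k<N. v k m x) = w N m x" for N m x
    unfolding v_def by (subst sum_lessThan_telescope) (simp add: w_def)
  define u where "u m x = (\<Sum>k. v k m x)" for m x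
  have lim: "uniform_limit (cball 0 R) (\<lambda>N. w N m) (u m) sequentially" for R m
  proof -
    obtain C where C: "C \<ge> 0"
      "\<And>u \<beta> k. has_growth R \<beta> k u \<Longrightarrow> has_growth R (C * \<beta> / Suc k) (Suc k) (volterra c j u)"
      using volterra_growth[of c R j, OF c] by metis
    obtain \<beta> where \<beta>: "\<beta> \<ge> 0" "has_growth R \<beta> 0 (v 0)"
      using continuous_has_growth_0[of "v 0" R, OF cv] by metis
    have "norm (v k m x) \<le> \<beta> * ((C * R) ^ k / fact k)" if "x \<in> cball 0 R" for k x
    proof -
      have x: "norm x \<le> R" using that by simp
      have "v (Suc k) = volterra c j (v k)" for k
        by (intro ext vS)
      from has_growthD(2)[OF volterra_iterate_growth[where v = v, OF C(2) this \<beta>(2)] x, of k m]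
        power_fact_bound[OF x \<beta>(1) C(1), of k] show ?thesis by simp
    qed
    then have "uniform_limit (cball 0 R) (\<lambda>N x. \<Sum>k<N. v k m x) (\<lambda>x. \<Sum>k. v k m x) sequentially"
      by (rule Weierstrass_m_test[OF _ summable_power_fact])
    then show ?thesis
      by (simp add: sum_v u_def[abs_def])
  qed
  have cu: "continuous_on UNIV (u m)" for m
  proof -
    have "isCont (u m) x" for x
    proof -
      have "continuous_on (cball 0 (norm x + 1)) (u m)"
        by (rule uniform_limit_theorem[OF _ lim])
          (auto intro!: always_eventually continuous_on_subset[OF cw])
      then show ?thesis
        by (rule continuous_on_interior) (simp add: mem_ball)
    qed
    then show ?thesis by (simp add: continuous_at_imp_continuous_on)
  qed
  have "u m x = b m x + volterra c j u m x" for m x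
  proof -
    obtain C where C: "C \<ge> 0" "\<And>u \<beta> k. has_growth (norm x) \<beta> k u \<Longrightarrow>
        has_growth (norm x) (C * \<beta> / Suc k) (Suc k) (volterra c j u)"
      using volterra_growth[of c "norm x" j, OF c] by metis
    have "(\<lambda>N. volterra c j (w N) m x) \<longlonglongrightarrow> volterra c j u m x"
    proof (rule tendstoI)
      fix e :: real assume "e > 0"
      \<comment> \<open>Adding 1 in the denominator keeps it positive when \<open>C * norm x\<close>
        vanishes and makes the final inequality strict.\<close>
      define \<epsilon> where "\<epsilon> = e / (C * norm x + 1)"
      have "C * norm x \<ge> 0" using C by simp
      then have \<epsilon>: "\<epsilon> > 0" "C * \<epsilon> * norm x < e"
        using \<open>e > 0\<close> by (auto simp: \<epsilon>_def field_simps add_pos_nonneg)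
      have "\<forall>\<^sub>F N in sequentially. \<forall>p. \<forall>y\<in>cball 0 (norm x). dist (w N p y) (u p y) < \<epsilon>"
        by (intro eventually_all_finite uniform_limitD[OF lim \<epsilon>(1)])
      then show "\<forall>\<^sub>F N in sequentially. dist (volterra c j (w N) m x) (volterra c j u m x) < e"
      proof eventually_elim
        case (elim N)
        have "has_growth (norm x) \<epsilon> 0 (\<lambda>p y. w N p y - u p y)"
          using elim by (auto simp: has_growth_def dist_real_def intro!: continuous_intros cw cu less_imp_le)
        from has_growthD(2)[OF C(2)[OF this], of x m] show ?case
          using \<epsilon> by (simp add: volterra_diff[OF c cw cu] dist_real_def)
      qed
    qed
    then have "(\<lambda>N. w (Suc N) m x) \<longlonglongrightarrow> b m x + volterra c j u m x"
      by (simp add: w_def tendsto_add)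
    moreover have "(\<lambda>N. w (Suc N) m x) \<longlonglongrightarrow> u m x"
      by (rule LIMSEQ_Suc, rule tendsto_uniform_limitI[OF lim[of m "norm x"]]) simp
    ultimately show ?thesis by (metis LIMSEQ_unique)
  qed
  with cu show thesis by (rule that)
qed

section \<open>Differentiating the Volterra equation\<close>

definition volterra_pd_rest ::
    "('n \<Rightarrow> 'm \<Rightarrow> 'm \<Rightarrow> real^'n \<Rightarrow> real) \<Rightarrow> nat \<Rightarrow> 'n \<Rightarrow> ('m::finite \<Rightarrow> real^'n \<Rightarrow> real) \<Rightarrow> 'm \<Rightarrow> real^'n \<Rightarrow> real" where
  "volterra_pd_rest c j i u m x = volterra (\<lambda>\<nu> p m. pd i (c \<nu> p m)) (Suc j) u m x
     + (\<Sum>p\<in>UNIV. rmean j (\<lambda>y. u p y * c i p m y) x)"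

lemma pd_sum:
  "finite S \<Longrightarrow> (\<And>a. a \<in> S \<Longrightarrow> f a differentiable (at x)) \<Longrightarrow> pd i (\<lambda>x. \<Sum>a\<in>S. f a x) x = (\<Sum>a\<in>S. pd i (f a) x)"
proof (induction S rule: finite_induct)
  case empty
  show ?case by (simp add: pd_eqI[where f' = "\<lambda>h. 0"])
next
  case (insert a S)
  then show ?case by (simp add: pd_add)
qed

text \<open>By the product rule the derivative hits \<open>u\<close>, a coefficient, or the
  prefactor x_\<nu>. The first case reproduces the operator with weight \<open>Suc j\<close>; the
  other two form \<open>volterra_pd_rest\<close>.\<close>

lemma pd_volterra:
  fixes u :: "'m::finite \<Rightarrow> real^'n \<Rightarrow> real"
  assumes c: "\<And>\<nu> p m. Ck 1 (c \<nu> p m)" and u: "\<And>p. Ck 1 (u p)"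
  shows "pd i (volterra c j u m) x = volterra c (Suc j) (\<lambda>p. pd i (u p)) m x + volterra_pd_rest c j i u m x"
proof -
  have cc: "continuous_on UNIV (c \<nu> p m)" "continuous_on UNIV (u p)"
     "continuous_on UNIV (pd i (c \<nu> p m))" "continuous_on UNIV (pd i (u p))" for \<nu> p m
    by (intro Ck_1D c u)+
  have uc: "Ck 1 (\<lambda>y. u p y * c \<nu> p m y)" for p \<nu> by (intro Ck_mult c u)
  have pduc: "pd i (\<lambda>y. u p y * c \<nu> p m y) = (\<lambda>y. pd i (u p) y * c \<nu> p m y + u p y * pd i (c \<nu> p m) y)" for p \<nu>
    using c u by (intro ext pd_mult) (auto simp: Ck_1_iff)
  have "pd i (\<lambda>x. x $ \<nu> * rmean j (\<lambda>y. u p y * c \<nu> p m y) x) x =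
     (if i = \<nu> then 1 else 0) * rmean j (\<lambda>y. u p y * c \<nu> p m y) x +
     x $ \<nu> * (rmean (Suc j) (\<lambda>y. pd i (u p) y * c \<nu> p m y) x + rmean (Suc j) (\<lambda>y. u p y * pd i (c \<nu> p m) y) x)" for \<nu> p
    by (subst pd_mult)
      (simp_all add: differentiable_nth rmean_differentiable[OF uc] pd_nth pd_rmean[OF uc] pduc rmean_add continuous_on_mult cc)
  moreover have "(\<lambda>x. x $ \<nu> * rmean j (\<lambda>y. u p y * c \<nu> p m y) x) differentiable (at x)" for \<nu> p
    by (intro differentiable_mult differentiable_nth rmean_differentiable uc)
  then have "pd i (volterra c j u m) x = (\<Sum>\<nu>\<in>UNIV. \<Sum>p\<in>UNIV. pd i (\<lambda>x. x $ \<nu> * rmean j (\<lambda>y. u p y * c \<nu> p m y) x) x)"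
    unfolding volterra_def[abs_def]
    by (simp add: pd_sum differentiable_sum)
  ultimately show ?thesis
    unfolding volterra_pd_rest_def volterra_def
    by (simp add: sum.distrib distrib_left if_distrib[of "\<lambda>x. x * _"] sum.delta sum.swap[of _ "UNIV::'m set" UNIV] cong: if_cong)
qed

text \<open>Only the coefficients lose an order of differentiability, since no derivative of
  \<open>u\<close> enters. This makes the regularity bootstrap possible.\<close>

lemma Ck_volterra_pd_rest:
  assumes "\<And>\<nu> p m. Ck (Suc k) (c \<nu> p m)" "\<And>p. Ck k (u p)"
  shows "Ck k (volterra_pd_rest c j i u m)"
  unfolding volterra_pd_rest_def[abs_def]
  using assms(1) by (intro Ck_add Ck_volterra Ck_sum Ck_rmean Ck_mult assms(2) Ck_SucD[OF assms(1)]) auto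

lemma volterra_pd_rest_diff:
  fixes u w :: "'m::finite \<Rightarrow> real^'n \<Rightarrow> real"
  assumes "\<And>\<nu> p m. Ck 1 (c \<nu> p m)" "\<And>p. continuous_on UNIV (u p)" "\<And>p. continuous_on UNIV (w p)"
  shows "volterra_pd_rest c j i (\<lambda>p y. u p y - w p y) m x = volterra_pd_rest c j i u m x - volterra_pd_rest c j i w m x"
proof -
  have cc: "continuous_on UNIV (c \<nu> p m)" "continuous_on UNIV (pd i (c \<nu> p m))" for \<nu> p m
    by (intro Ck_1D assms)+
  show ?thesis
    unfolding volterra_pd_rest_def
    by (simp add: volterra_diff cc assms left_diff_distrib rmean_diff continuous_on_mult sum_subtractf)
qed

text \<open>The order stays at k, unlike for \<open>volterra\<close>: the term from differentiating
  x_\<nu> has no prefactor left. In the other term the extra factor is absorbed by the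
  radius.\<close>

lemma volterra_pd_rest_growth:
  fixes c :: "'n::finite \<Rightarrow> 'm::finite \<Rightarrow> 'm \<Rightarrow> real^'n \<Rightarrow> real"
  assumes c: "\<And>\<nu> p m. Ck 1 (c \<nu> p m)"
  obtains C where "C \<ge> 0"
    "\<And>u \<beta> k. has_growth R \<beta> k u \<Longrightarrow> has_growth R (C * \<beta>) k (volterra_pd_rest c j i u)"
proof -
  have cc: "continuous_on UNIV (c \<nu> p m)" "continuous_on UNIV (pd i (c \<nu> p m))" for \<nu> p m
    by (intro Ck_1D c)+
  obtain K where K: "K \<ge> 0" "\<And>\<nu> p m y. norm y \<le> R \<Longrightarrow> \<bar>c \<nu> p m y\<bar> \<le> K"
    using continuous_bounded_cball[of "\<lambda>(\<nu>, p, m). c \<nu> p m" R] cc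
    by (simp add: split_beta split_paired_all) metis
  obtain C where C: "C \<ge> 0" "\<And>u \<beta> k. has_growth R \<beta> k u \<Longrightarrow>
        has_growth R (C * \<beta> / Suc k) (Suc k) (volterra (\<lambda>\<nu> p m. pd i (c \<nu> p m)) (Suc j) u)"
    using volterra_growth[of "\<lambda>\<nu> p m. pd i (c \<nu> p m)" R "Suc j"] cc by metis
  \<comment> \<open>The absolute value keeps the constant nonnegative whatever the sign of
    R.\<close>
  have "has_growth R ((C * \<bar>R\<bar> + CARD('m) * K) * \<beta>) k (volterra_pd_rest c j i u)"
    if growth: "has_growth R \<beta> k u" for u \<beta> k
  proof -
    note u = has_growthD[OF growth]
    have "\<bar>volterra_pd_rest c j i u m x\<bar> \<le> ((C * \<bar>R\<bar> + CARD('m) * K) * \<beta>) * norm x ^ k"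
      if x: "norm x \<le> R" for m x
    proof -
      have \<beta>x: "0 \<le> \<beta> * norm x ^ k" using order_trans[OF abs_ge_zero u(2)[OF x]] .
      have le: "a / real (Suc k) \<le> a" if "a \<ge> 0" for a :: real
        using that mult_left_mono[of 1 "real (Suc k)" a] by (simp add: divide_le_eq)
      have "\<bar>volterra (\<lambda>\<nu> p m. pd i (c \<nu> p m)) (Suc j) u m x\<bar> \<le> (C * \<beta> / Suc k) * norm x ^ Suc k"
        by (rule has_growthD(2)[OF C(2)[OF growth] x])
      also have "\<dots> = (C * norm x) * (\<beta> * norm x ^ k) / Suc k" by simp
      also have "\<dots> \<le> (C * norm x) * (\<beta> * norm x ^ k)"
        by (rule le[OF mult_nonneg_nonneg[OF mult_nonneg_nonneg[OF C(1) norm_ge_zero] \<beta>x]])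
      also have "\<dots> \<le> (C * \<bar>R\<bar>) * (\<beta> * norm x ^ k)"
        using C \<beta>x x by (intro mult_right_mono mult_left_mono) auto
      finally have 1: "\<bar>volterra (\<lambda>\<nu> p m. pd i (c \<nu> p m)) (Suc j) u m x\<bar> \<le> (C * \<bar>R\<bar>) * (\<beta> * norm x ^ k)" .
      have "\<bar>rmean j (\<lambda>y. u p y * c i p m y) x\<bar> \<le> K * (\<beta> * norm x ^ k)" for p
      proof -
        have "\<bar>rmean j (\<lambda>y. u p y * c i p m y) x\<bar> \<le> K * \<beta> * norm x ^ k / (k + 1)"
          by (rule rmean_mult_bound[OF u(1) cc(1) x u(2) K(2)])
        also have "\<dots> = K * (\<beta> * norm x ^ k) / Suc k" by simp
        also have "\<dots> \<le> K * (\<beta> * norm x ^ k)"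
          by (rule le[OF mult_nonneg_nonneg[OF K(1) \<beta>x]])
        finally show ?thesis .
      qed
      then have 2: "\<bar>\<Sum>p\<in>UNIV. rmean j (\<lambda>y. u p y * c i p m y) x\<bar> \<le> CARD('m) * (K * (\<beta> * norm x ^ k))"
        by (intro order_trans[OF sum_abs] order_trans[OF sum_bounded_above]) auto
      show ?thesis
        unfolding volterra_pd_rest_def
        using order_trans[OF abs_triangle_ineq add_mono[OF 1 2]] by (simp add: algebra_simps)
    qed
    moreover have "continuous_on UNIV (volterra_pd_rest c j i u m)" for m
      using Ck_volterra_pd_rest[of 0 c u] c u(1) by simp
    ultimately show ?thesis by (auto simp: has_growth_def)
  qed
  moreover have "C * \<bar>R\<bar> + CARD('m) * K \<ge> 0" using C K by simp
  ultimately show thesis by (rule that[rotated])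
qed

text \<open>The formally differentiated equation is solved first, giving candidates for the partial
  derivatives. The derivatives of the Picard iterates converge to these candidates locally
  uniformly, while the iterates converge to the given \<open>u\<close>.\<close>

lemma volterra_solution_C1:
  fixes c :: "'n::finite \<Rightarrow> 'm::finite \<Rightarrow> 'm \<Rightarrow> real^'n \<Rightarrow> real"
  assumes c: "\<And>\<nu> p m. Ck 1 (c \<nu> p m)" and b: "\<And>m. Ck 1 (b m)"
    and u: "\<And>m. continuous_on UNIV (u m)" and eq: "\<And>m x. u m x = b m x + volterra c j u m x"
  shows "Ck 1 (u m)"
proof -
  define w where "w = picard c j b"
  have w1: "Ck 1 (w k p)" for k p
    unfolding w_def by (intro Ck_picard c b)
  have w_Suc: "w (Suc k) = (\<lambda>m x. b m x + volterra c j (w k) m x)" for k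
    by (simp add: w_def)
  have cc: "continuous_on UNIV (c \<nu> p m)" for \<nu> p m
    by (intro Ck_1D c)
  have cw: "continuous_on UNIV (w k p)" for k p
    by (intro Ck_1D w1)
  have rest: "continuous_on UNIV (volterra_pd_rest c j i u m)" for i m
    using Ck_volterra_pd_rest[of 0 c u] c u by simp
  \<comment> \<open>This equation makes sense for a merely continuous \<open>u\<close>, because
    \<open>u\<close> enters only through \<open>volterra_pd_rest\<close>.\<close>
  have "\<exists>d. (\<forall>m. continuous_on UNIV (d m)) \<and>
      (\<forall>m x. d m x = (pd i (b m) x + volterra_pd_rest c j i u m x) + volterra c (Suc j) d m x)" for i
  proof -
    have "continuous_on UNIV (\<lambda>x. pd i (b m) x + volterra_pd_rest c j i u m x)" for m
      by (intro continuous_on_add rest Ck_1D b)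
    then show ?thesis
      by (rule volterra_solution_exists[of c "\<lambda>m x. pd i (b m) x + volterra_pd_rest c j i u m x" "Suc j", OF cc]) blast
  qed
  then obtain d where cd: "\<And>i m. continuous_on UNIV (d i m)"
    and d: "\<And>i m x. d i m x = (pd i (b m) x + volterra_pd_rest c j i u m x) + volterra c (Suc j) (d i) m x"
    by metis
  have cpw: "continuous_on UNIV (pd i (w k p))" for i k p
    by (intro Ck_1D w1)
  \<comment> \<open>\<eta> is the error of the iterates, \<delta> the error of their partial
    derivatives against the candidates. Subtracting the equations removes \<open>b\<close>: \<eta>
    satisfies the homogeneous recursion, \<delta> the one of weight \<open>Suc j\<close> driven by
    \<eta>.\<close>
  define \<eta> where "\<eta> k p y = w k p y - u p y" for k p y
  define \<delta> where "\<delta> i k p y = pd i (w k p) y - d i p y" for i k p y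
  have c\<eta>: "continuous_on UNIV (\<eta> k p)" for k p
    unfolding \<eta>_def[abs_def] by (intro continuous_intros cw u)
  have c\<delta>: "continuous_on UNIV (\<delta> i k p)" for i k p
    unfolding \<delta>_def[abs_def] by (intro continuous_intros cpw cd)
  have \<eta>_Suc: "\<eta> (Suc k) m x = volterra c j (\<eta> k) m x" for k m x
    unfolding \<eta>_def[abs_def] volterra_diff[OF cc cw u] using eq by (simp add: w_Suc)
  have \<delta>_Suc: "\<delta> i (Suc k) m x = volterra c (Suc j) (\<delta> i k) m x + volterra_pd_rest c j i (\<eta> k) m x" for i k m x
  proof -
    have "pd i (w (Suc k) m) x = pd i (b m) x + pd i (volterra c j (w k) m) x"
      unfolding w_Suc by (intro pd_add Ck_1D b Ck_volterra c w1)
    then show ?thesis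
      unfolding \<delta>_def[abs_def] \<eta>_def[abs_def] volterra_diff[OF cc cpw cd] volterra_pd_rest_diff[OF c cw u]
      using d[of i m x] by (simp add: pd_volterra[OF c w1])
  qed
  have \<eta>_bound: "\<exists>\<beta> C. \<beta> \<ge> 0 \<and> C \<ge> 0 \<and> (\<forall>k. has_growth R (\<beta> * C ^ k / fact k) k (\<eta> k))" for R
  proof -
    obtain C where C: "C \<ge> 0"
      "\<And>u \<beta> k. has_growth R \<beta> k u \<Longrightarrow> has_growth R (C * \<beta> / Suc k) (Suc k) (volterra c j u)"
      using volterra_growth[of c R j, OF cc] by metis
    obtain \<beta> where \<beta>: "\<beta> \<ge> 0" "has_growth R \<beta> 0 (\<eta> 0)"
      using continuous_has_growth_0[of "\<eta> 0" R, OF c\<eta>] by metis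
    have "\<eta> (Suc k) = volterra c j (\<eta> k)" for k
      by (intro ext \<eta>_Suc)
    from volterra_iterate_growth[where v = \<eta>, OF C(2) this \<beta>(2)] C(1) \<beta>(1) show ?thesis by blast
  qed
  \<comment> \<open>The driving term does not raise the order of \<eta>, so \<delta> lags one index
    behind: \<open>\<delta> i (Suc k)\<close> has order k.\<close>
  have \<delta>_bound: "\<exists>D L. D \<ge> 0 \<and> L \<ge> 0 \<and> (\<forall>k. has_growth R (D * L ^ k / fact k) k (\<delta> i (Suc k)))" for i R
  proof -
    obtain \<beta> C where \<beta>: "\<beta> \<ge> 0" "C \<ge> 0" "\<And>k. has_growth R (\<beta> * C ^ k / fact k) k (\<eta> k)"
      using \<eta>_bound by metis
    obtain C1 where C1: "C1 \<ge> 0"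
      "\<And>u \<beta> k. has_growth R \<beta> k u \<Longrightarrow> has_growth R (C1 * \<beta> / Suc k) (Suc k) (volterra c (Suc j) u)"
      using volterra_growth[of c R "Suc j", OF cc] by metis
    obtain C2 where C2: "C2 \<ge> 0"
      "\<And>u \<beta> k. has_growth R \<beta> k u \<Longrightarrow> has_growth R (C2 * \<beta>) k (volterra_pd_rest c j i u)"
      using volterra_pd_rest_growth[of c R j i, OF c] by metis
    obtain D0 where D0: "D0 \<ge> 0" "has_growth R D0 0 (\<delta> i (Suc 0))"
      using continuous_has_growth_0[of "\<delta> i (Suc 0)" R, OF c\<delta>] by metis
    \<comment> \<open>D dominates the initial error and \<open>\<beta> * C\<close>; L dominates C
      and \<open>C1 + C2\<close>. Both contributions to the next error then fit under D *
      L^(k+1).\<close>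
    define D where "D = D0 + \<beta> * C"
    define L where "L = C1 + C2 + C"
    have D: "0 \<le> D" "D0 \<le> D" "\<beta> * C \<le> D" and L: "0 \<le> L" "C \<le> L" "C1 + C2 \<le> L"
      using D0(1) \<beta> C1(1) C2(1) by (auto simp: D_def L_def)
    have "has_growth R (D * L ^ k / fact k) k (\<delta> i (Suc k))" for k
    proof (induction k)
      case 0
      have "\<bar>\<delta> i (Suc 0) p y\<bar> \<le> D" if "norm y \<le> R" for p y
        using has_growthD(2)[OF D0(2) that, of p] D by simp
      with c\<delta> show ?case by (simp add: has_growth_def)
    next
      case (Suc k)
      have "(\<beta> * C) * C ^ k \<le> D * L ^ k"
        using D L \<beta> by (intro mult_mono power_mono) auto
      then have "C2 * ((\<beta> * C) * C ^ k) \<le> C2 * (D * L ^ k)"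
        using C2(1) by (rule mult_left_mono)
      moreover have "(C1 + C2) * (D * L ^ k) \<le> L * (D * L ^ k)"
        using D L by (intro mult_right_mono) auto
      ultimately have DL: "C1 * (D * L ^ k) + C2 * (\<beta> * C ^ Suc k) \<le> D * L ^ Suc k"
        by (simp add: algebra_simps)
      have eq: "(C1 * (P / f) / s) * n + (C2 * (Q / (s * f))) * n = (C1 * P + C2 * Q) * (n / (s * f))" for P Q f s n :: real
        by (simp add: algebra_simps add_divide_distrib)
      have "\<bar>\<delta> i (Suc (Suc k)) p y\<bar> \<le> (D * L ^ Suc k / fact (Suc k)) * norm y ^ Suc k" if y: "norm y \<le> R" for p y
      proof -
        have "\<bar>\<delta> i (Suc (Suc k)) p y\<bar> \<le> (C1 * (D * L ^ k / fact k) / Suc k) * norm y ^ Suc k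
            + (C2 * (\<beta> * C ^ Suc k / fact (Suc k))) * norm y ^ Suc k"
          unfolding \<delta>_Suc[of i "Suc k"]
          by (intro order_trans[OF abs_triangle_ineq] add_mono
              has_growthD(2)[OF C1(2)[OF Suc] y] has_growthD(2)[OF C2(2)[OF \<beta>(3)] y])
        also have "\<dots> = (C1 * (D * L ^ k) + C2 * (\<beta> * C ^ Suc k)) * (norm y ^ Suc k / fact (Suc k))"
          unfolding fact_Suc by (rule eq)
        also have "\<dots> \<le> D * L ^ Suc k * (norm y ^ Suc k / fact (Suc k))"
          by (rule mult_right_mono[OF DL]) simp
        finally show ?thesis by simp
      qed
      with c\<delta> show ?case unfolding has_growth_def by blast
    qed
    with D L show ?thesis by blast
  qed
  have small: "\<forall>\<^sub>F k in sequentially. \<beta> * (z ^ k / fact k) < e" if "e > 0" for \<beta> z e :: real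
    using order_tendstoD(2)[OF summable_LIMSEQ_zero[OF summable_power_fact] that] .
  have der: "(u m has_derivative (\<lambda>h. \<Sum>i\<in>UNIV. h $ i * d i m x)) (at x)" for x
  proof -
    define R where "R = norm x + 1"
    have lim: "(\<lambda>k. w (Suc k) m y) \<longlonglongrightarrow> u m y" if "norm y \<le> R" for y
    proof -
      obtain \<beta> C where \<beta>: "\<beta> \<ge> 0" "C \<ge> 0" "\<And>k. has_growth R (\<beta> * C ^ k / fact k) k (\<eta> k)"
        using \<eta>_bound by metis
      have "(\<lambda>k. w k m y) \<longlonglongrightarrow> u m y"
      proof (rule tendstoI)
        fix e :: real assume "e > 0"
        show "\<forall>\<^sub>F k in sequentially. dist (w k m y) (u m y) < e"
          using small[OF \<open>e > 0\<close>, of \<beta> "C * R"]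
        proof eventually_elim
          case (elim k)
          then show ?case
            using has_growthD(2)[OF \<beta>(3) that, of k m] power_fact_bound[OF that \<beta>(1,2), of k]
            by (simp add: \<eta>_def dist_real_def)
        qed
      qed
      then show ?thesis by (rule LIMSEQ_Suc)
    qed
    have "\<exists>g. \<forall>y\<in>ball 0 R. (\<lambda>k. w (Suc k) m y) \<longlonglongrightarrow> g y \<and>
        (g has_derivative (\<lambda>h. \<Sum>i\<in>UNIV. h $ i * d i m y)) (at y within ball 0 R)"
    proof (rule has_derivative_sequence)
      show "(w (Suc k) m has_derivative (\<lambda>h. \<Sum>i\<in>UNIV. h $ i * pd i (w (Suc k) m) y)) (at y within ball 0 R)" for k y
        by (rule has_derivative_at_withinI[OF has_derivative_pd[OF Ck_1D(1)[OF w1]]])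
      show "(\<lambda>k. w (Suc k) m 0) \<longlonglongrightarrow> u m 0"
        by (rule lim) (simp add: R_def)
      show "0 \<in> ball 0 R" by (simp add: R_def add_nonneg_pos)
      fix e :: real assume "e > 0"
      \<comment> \<open>The total error in direction h sums one contribution per coordinate, hence
        the division by the dimension.\<close>
      then have e: "e / CARD('n) > 0" by simp
      have "\<forall>\<^sub>F k in sequentially. \<forall>i. \<forall>y\<in>ball 0 R. \<bar>\<delta> i (Suc k) m y\<bar> < e / CARD('n)"
      proof (rule eventually_all_finite)
        fix i
        obtain D L where D: "D \<ge> 0" "L \<ge> 0" "\<And>k. has_growth R (D * L ^ k / fact k) k (\<delta> i (Suc k))"
          using \<delta>_bound by metis
        show "\<forall>\<^sub>F k in sequentially. \<forall>y\<in>ball 0 R. \<bar>\<delta> i (Suc k) m y\<bar> < e / CARD('n)"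
          using small[OF e, of D "L * R"]
        proof eventually_elim
          case (elim k)
          show ?case
          proof
            fix y :: "real^'n" assume "y \<in> ball 0 R"
            then have y: "norm y \<le> R" by simp
            show "\<bar>\<delta> i (Suc k) m y\<bar> < e / CARD('n)"
              using elim has_growthD(2)[OF D(3) y, of k m] power_fact_bound[OF y D(1,2), of k] by linarith
          qed
        qed
      qed
      then show "\<forall>\<^sub>F k in sequentially. \<forall>y\<in>ball 0 R. \<forall>h.
          norm ((\<Sum>i\<in>UNIV. h $ i * pd i (w (Suc k) m) y) - (\<Sum>i\<in>UNIV. h $ i * d i m y)) \<le> e * norm h"
      proof eventually_elim
        case (elim k)
        show ?case
        proof (intro ballI allI)
          fix y h :: "real^'n" assume y: "y \<in> ball 0 R"
          have "norm ((\<Sum>i\<in>UNIV. h $ i * pd i (w (Suc k) m) y) - (\<Sum>i\<in>UNIV. h $ i * d i m y))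
              = \<bar>\<Sum>i\<in>UNIV. h $ i * \<delta> i (Suc k) m y\<bar>"
            by (simp add: \<delta>_def sum_subtractf right_diff_distrib)
          also have "\<dots> \<le> (\<Sum>i\<in>(UNIV::'n set). norm h * (e / CARD('n)))"
            unfolding abs_mult[symmetric]
            by (rule order_trans[OF sum_abs], unfold abs_mult, intro sum_mono mult_mono component_le_norm_cart)
              (use elim y in \<open>auto intro: less_imp_le\<close>)
          finally show "norm ((\<Sum>i\<in>UNIV. h $ i * pd i (w (Suc k) m) y) - (\<Sum>i\<in>UNIV. h $ i * d i m y)) \<le> e * norm h"
            by (simp add: mult.commute)
        qed
      qed
    qed (rule convex_ball)
    then obtain g where g: "\<And>y. y \<in> ball 0 R \<Longrightarrow> (\<lambda>k. w (Suc k) m y) \<longlonglongrightarrow> g y"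
      "\<And>y. y \<in> ball 0 R \<Longrightarrow> (g has_derivative (\<lambda>h. \<Sum>i\<in>UNIV. h $ i * d i m y)) (at y within ball 0 R)"
      by blast
    \<comment> \<open>The limit returned by \<open>has_derivative_sequence\<close> is anonymous; it
      is identified with \<open>u\<close> through the known limit of the iterates.\<close>
    have gu: "g y = u m y" if "y \<in> ball 0 R" for y
      using LIMSEQ_unique[OF g(1)[OF that] lim] that by simp
    have x: "x \<in> ball 0 R" by (simp add: R_def)
    have "(g has_derivative (\<lambda>h. \<Sum>i\<in>UNIV. h $ i * d i m x)) (at x)"
      using g(2)[OF x] unfolding at_within_open[OF x open_ball] .
    then show ?thesis
      by (rule has_derivative_transform_within_open[OF _ open_ball x gu])
  qed
  have "pd i (u m) = d i m" for i
    by (intro ext) (simp add: pd_eqI[OF der])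
  moreover have "\<forall>x. u m differentiable (at x)"
    using der differentiableI by blast
  ultimately show ?thesis
    unfolding Ck_1_iff using cd by simp
qed

text \<open>The induction leaves \<open>j\<close>, \<open>b\<close> and \<open>u\<close> free and is
  used twice: first to get order k for \<open>u\<close>, hence for the right-hand side of the
  differentiated equation, and then for the partial derivatives, which solve that equation.\<close>

lemma volterra_solution_Ck:
  fixes c :: "'n::finite \<Rightarrow> 'm::finite \<Rightarrow> 'm \<Rightarrow> real^'n \<Rightarrow> real"
  assumes c: "\<And>k \<nu> p m. Ck k (c \<nu> p m)" and "\<And>m. Ck k (b m)"
    and "\<And>m. continuous_on UNIV (u m)" and "\<And>m x. u m x = b m x + volterra c j u m x"
  shows "Ck k (u m)"
  using assms(2-)
proof (induction k arbitrary: j b u m)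
  case (Suc k)
  have b1: "Ck 1 (b m)" for m using Suc.prems(1) by (rule Ck_imp_Ck1)
  have u1: "Ck 1 (u m)" for m by (rule volterra_solution_C1[OF c b1 Suc.prems(2,3)])
  have uk: "Ck k (u m)" for m
    by (rule Suc.IH[OF Ck_SucD[OF Suc.prems(1)] Suc.prems(2,3)])
  have "Ck k (pd i (u m))" for i m
  proof (rule Suc.IH[of "\<lambda>m x. pd i (b m) x + volterra_pd_rest c j i u m x" "\<lambda>m. pd i (u m)" "Suc j"])
    show "Ck k (\<lambda>x. pd i (b m) x + volterra_pd_rest c j i u m x)" for m
      using Suc.prems(1) by (intro Ck_add Ck_volterra_pd_rest c uk) auto
    show "continuous_on UNIV (pd i (u m))" for m by (intro Ck_1D u1)
    fix m x
    have "u m = (\<lambda>x. b m x + volterra c j u m x)" using Suc.prems(3) by blast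
    then have "pd i (u m) x = pd i (\<lambda>x. b m x + volterra c j u m x) x" by simp
    also have "\<dots> = pd i (b m) x + pd i (volterra c j u m) x"
      by (intro pd_add Ck_1D b1 Ck_volterra c u1)
    finally show "pd i (u m) x = pd i (b m) x + volterra_pd_rest c j i u m x + volterra c (Suc j) (\<lambda>m. pd i (u m)) m x"
      by (simp add: pd_volterra[OF c u1])
  qed
  with u1 show ?case by (auto intro: Ck_1D)
qed simp

text \<open>The Volterra equation with weight 0 and constant right-hand side is the integrated form
  of the radial equation. Using means over the unit interval makes the solution smooth across the
  origin.\<close>

lemma radial_linear_ode_solution:
  fixes c :: "'n::finite \<Rightarrow> 'm::finite \<Rightarrow> 'm \<Rightarrow> real^'n \<Rightarrow> real" and u0 :: "'m \<Rightarrow> real"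
  assumes c: "\<And>\<nu> p m. smooth_fun (c \<nu> p m)"
  obtains u where "\<And>m. smooth_fun (u m)" "\<And>m. u m 0 = u0 m"
    "\<And>m x t. ((\<lambda>s. u m (s *\<^sub>R x)) has_real_derivative
       (\<Sum>\<nu>\<in>UNIV. \<Sum>p\<in>UNIV. x $ \<nu> * (u p (t *\<^sub>R x) * c \<nu> p m (t *\<^sub>R x)))) (at t)"
proof -
  have ck: "Ck k (c \<nu> p m)" for k \<nu> p m using c smooth_fun_iff_Ck by blast
  obtain u where u: "\<And>m. continuous_on UNIV (u m)" "\<And>m x. u m x = u0 m + volterra c 0 u m x"
    using volterra_solution_exists[of c "\<lambda>m x. u0 m" 0] Ck_1D(2)[OF ck] by auto
  have uk: "Ck k (u m)" for k m
    by (rule volterra_solution_Ck[OF ck _ u]) simp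
  have "((\<lambda>s. u m (s *\<^sub>R x)) has_real_derivative
       (\<Sum>\<nu>\<in>UNIV. \<Sum>p\<in>UNIV. x $ \<nu> * (u p (t *\<^sub>R x) * c \<nu> p m (t *\<^sub>R x)))) (at t)" for m x t
  proof -
    define f where "f \<nu> p = (\<lambda>y. u p y * c \<nu> p m y)" for \<nu> p
    have f1: "Ck 1 (f \<nu> p)" for \<nu> p unfolding f_def by (intro Ck_mult uk ck)
    have D: "((\<lambda>s. s * rmean 0 (f \<nu> p) (s *\<^sub>R x)) has_real_derivative f \<nu> p (t *\<^sub>R x)) (at t)" for \<nu> p
    proof -
      have "((\<lambda>s. s * rmean 0 (f \<nu> p) (s *\<^sub>R x)) has_real_derivative
          1 * rmean 0 (f \<nu> p) (t *\<^sub>R x) + t * (\<Sum>i\<in>UNIV. x $ i * pd i (rmean 0 (f \<nu> p)) (t *\<^sub>R x))) (at t)"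
        by (rule derivative_eq_intros has_real_derivative_ray rmean_differentiable f1 refl)+ simp
      \<comment> \<open>The outer factor t moves into the coordinates, turning x into the base point
        tx at which \<open>rmean_Euler\<close> is applied.\<close>
      also have "1 * rmean 0 (f \<nu> p) (t *\<^sub>R x) + t * (\<Sum>i\<in>UNIV. x $ i * pd i (rmean 0 (f \<nu> p)) (t *\<^sub>R x))
          = rmean 0 (f \<nu> p) (t *\<^sub>R x) + (\<Sum>i\<in>UNIV. (t *\<^sub>R x) $ i * rmean 1 (pd i (f \<nu> p)) (t *\<^sub>R x))"
        by (simp add: pd_rmean[OF f1] sum_distrib_left mult_ac)
      also have "\<dots> = f \<nu> p (t *\<^sub>R x)" by (rule rmean_Euler[OF f1])
      finally show ?thesis .
    qed
    have "((\<lambda>s. u0 m + (\<Sum>\<nu>\<in>UNIV. \<Sum>p\<in>UNIV. x $ \<nu> * (s * rmean 0 (f \<nu> p) (s *\<^sub>R x)))) has_real_derivative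
       0 + (\<Sum>\<nu>\<in>UNIV. \<Sum>p\<in>UNIV. x $ \<nu> * f \<nu> p (t *\<^sub>R x))) (at t)"
      by (intro DERIV_add DERIV_const DERIV_sum DERIV_cmult D)
    moreover have "u m (s *\<^sub>R x) = u0 m + (\<Sum>\<nu>\<in>UNIV. \<Sum>p\<in>UNIV. x $ \<nu> * (s * rmean 0 (f \<nu> p) (s *\<^sub>R x)))" for s
      by (subst u(2)) (simp add: volterra_def f_def mult_ac)
    ultimately show ?thesis by (simp add: f_def)
  qed
  moreover have "u m 0 = u0 m" for m by (subst u(2)) (simp add: volterra_def)
  moreover have "smooth_fun (u m)" for m using uk smooth_fun_iff_Ck by blast
  ultimately show thesis using that by blast
qed

section \<open>Matrix calculus along rays\<close>

lemma matrix_inv_mult: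
  fixes A :: "real^'n^'n"
  assumes "invertible A"
  shows "A ** matrix_inv A = mat 1" "matrix_inv A ** A = mat 1"
  using someI_ex[OF assms[unfolded invertible_def]] by (auto simp: matrix_inv_def)

lemma mat_inverse_eq_matrix_inv: "mat_inverse A = matrix_inv A"
  by (simp add: mat_inverse_def matrix_inv_def)

lemma matrix_inv_unique:
  fixes A :: "real^'n^'n"
  assumes "A ** B = mat 1"
  shows "matrix_inv A = B"
proof -
  have "B ** A = mat 1" using assms matrix_left_right_inverse by blast
  then have "invertible A" using assms invertible_def by blast
  then have "matrix_inv A ** (A ** B) = B" using matrix_inv_mult(2)[of A] by (simp add: matrix_mul_assoc)
  with assms show ?thesis by simp
qed

lemma transpose_matrix_inv:
  fixes A :: "real^'n^'n"
  assumes "invertible A"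
  shows "transpose (matrix_inv A) = matrix_inv (transpose A)"
  by (rule matrix_inv_unique[symmetric]) (simp add: matrix_transpose_mul[symmetric] matrix_inv_mult assms)

text \<open>Cramer's rule for a column of the inverse. Entries become polynomials in the entries of
  A times the reciprocal of a determinant, from which smoothness of the inverse field
  follows.\<close>

lemma matrix_inv_entry:
  fixes A :: "real^'n^'n"
  assumes "invertible A"
  shows "matrix_inv A $ k $ n = det (\<chi> i j. if j = k then axis n 1 $ i else A $ i $ j) * inverse (det A)"
proof -
  have "A *v (matrix_inv A *v axis n 1) = axis n 1"
    by (simp add: matrix_vector_mul_assoc matrix_inv_mult assms)
  then have "matrix_inv A *v axis n 1 = (\<chi> k. det (\<chi> i j. if j = k then axis n 1 $ i else A $ i $ j) / det A)"
    using cramer assms invertible_det_nz by blast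
  then have "(matrix_inv A *v axis n 1) $ k = det (\<chi> i j. if j = k then axis n 1 $ i else A $ i $ j) / det A"
    by simp
  moreover have "(matrix_inv A *v axis n 1) $ k = matrix_inv A $ k $ n"
    by (simp add: matrix_vector_mul_component inner_axis)
  ultimately show ?thesis by (simp add: divide_inverse)
qed

lemma Ck_det:
  assumes "\<And>i j. Ck k (\<lambda>x. E x $ i $ j)"
  shows "Ck k (\<lambda>x. det (E x))"
  unfolding det_def by (intro Ck_sum Ck_mult Ck_prod Ck_const assms)

lemma smooth_matrix_field_iff_Ck: "smooth_matrix_field E \<longleftrightarrow> (\<forall>k a m. Ck k (\<lambda>x. E x $ a $ m))"
  unfolding smooth_matrix_field_def smooth_fun_iff_Ck by blast

lemma smooth_matrix_inv:
  assumes "smooth_matrix_field E" "\<And>x. invertible (E x)"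
  shows "smooth_matrix_field (\<lambda>x. matrix_inv (E x))"
proof -
  have E: "Ck k (\<lambda>x. E x $ a $ m)" for k a m
    using assms(1) smooth_matrix_field_iff_Ck by blast
  have "Ck k (\<lambda>x. (\<chi> i j. if j = a then axis m 1 $ i else E x $ i $ j) $ i $ j)" for k a i j m
    using E by (cases "j = a") auto
  moreover have "det (E x) \<noteq> 0" for x
    using assms(2)[of x] by (simp add: invertible_det_nz)
  ultimately show ?thesis
    unfolding smooth_matrix_field_iff_Ck matrix_inv_entry[OF assms(2)]
    by (intro allI Ck_mult Ck_inverse Ck_det E) auto
qed

lemma smooth_matrix_mult:
  assumes "smooth_matrix_field E" "smooth_matrix_field F"
  shows "smooth_matrix_field (\<lambda>x. E x ** F x)"
  using assms unfolding smooth_matrix_field_iff_Ck matrix_matrix_mult_def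
  by (auto intro!: Ck_sum Ck_mult)

lemma smooth_matrix_transpose: "smooth_matrix_field E \<Longrightarrow> smooth_matrix_field (\<lambda>x. transpose (E x))"
  unfolding smooth_matrix_field_def transpose_def by simp

section \<open>Derivatives of matrix fields along rays\<close>

definition has_matrix_derivative :: "(real \<Rightarrow> real^'n^'n) \<Rightarrow> real^'n^'n \<Rightarrow> real \<Rightarrow> bool" where
  "has_matrix_derivative A A' t \<longleftrightarrow> (\<forall>i j. ((\<lambda>s. A s $ i $ j) has_real_derivative A' $ i $ j) (at t))"

lemma has_matrix_derivative_mult:
  assumes "has_matrix_derivative A A' t" "has_matrix_derivative B B' t"
  shows "has_matrix_derivative (\<lambda>s. A s ** B s) (A' ** B t + A t ** B') t"
  using assms unfolding has_matrix_derivative_def matrix_matrix_mult_def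
  by (auto intro!: derivative_eq_intros simp: sum.distrib[symmetric] algebra_simps)

lemma has_matrix_derivative_transpose:
  "has_matrix_derivative A A' t \<Longrightarrow> has_matrix_derivative (\<lambda>s. transpose (A s)) (transpose A') t"
  unfolding has_matrix_derivative_def transpose_def by simp

lemma has_matrix_derivative_const: "has_matrix_derivative (\<lambda>s. A) 0 t"
  unfolding has_matrix_derivative_def by simp

lemma has_matrix_derivative_unique:
  "has_matrix_derivative A D t \<Longrightarrow> has_matrix_derivative A D' t \<Longrightarrow> D = D'"
  unfolding has_matrix_derivative_def vec_eq_iff using DERIV_unique by blast

lemma has_matrix_derivative_vector:
  "has_matrix_derivative A A' t \<Longrightarrow> ((\<lambda>s. (A s *v x) $ a) has_real_derivative (A' *v x) $ a) (at t)"
  unfolding has_matrix_derivative_def matrix_vector_mult_def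
  by (auto intro!: derivative_eq_intros simp: mult_ac)

lemma real_derivative_eq_imp_eq:
  fixes f g :: "real \<Rightarrow> real"
  assumes "\<And>t. (f has_real_derivative D t) (at t)" "\<And>t. (g has_real_derivative D t) (at t)" "f 0 = g 0"
  shows "f t = g t"
proof -
  have "((\<lambda>t. f t - g t) has_real_derivative 0) (at t)" for t
    using DERIV_diff[OF assms(1,2), of t] by simp
  then have "f t - g t = f 0 - g 0"
    using DERIV_isconst_all[of "\<lambda>t. f t - g t"] by blast
  with assms(3) show ?thesis by simp
qed

lemma has_matrix_derivative_eq_imp_eq:
  assumes "\<And>t. has_matrix_derivative A (D t) t" "\<And>t. has_matrix_derivative B (D t) t" "A 0 = B 0"
  shows "A t = B t"
proof -
  have "A t $ i $ j = B t $ i $ j" for i j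
    by (rule real_derivative_eq_imp_eq[where D = "\<lambda>t. D t $ i $ j"])
      (use assms in \<open>auto simp: has_matrix_derivative_def\<close>)
  then show ?thesis by (simp add: vec_eq_iff)
qed

text \<open>Direction and base point are separate arguments: the radial equation needs direction x
  at the point tx, the Lie derivative direction tx at tx. The two differ by the factor t.\<close>

definition ray_derivative :: "(real^'n \<Rightarrow> real^'n^'n) \<Rightarrow> real^'n \<Rightarrow> real^'n \<Rightarrow> real^'n^'n" where
  "ray_derivative E v y = (\<chi> a m. \<Sum>i\<in>UNIV. v $ i * pd i (\<lambda>z. E z $ a $ m) y)"

lemma has_matrix_derivative_ray:
  assumes "smooth_matrix_field E"
  shows "has_matrix_derivative (\<lambda>s. E (s *\<^sub>R x)) (ray_derivative E x (t *\<^sub>R x)) t"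
  using assms unfolding has_matrix_derivative_def ray_derivative_def smooth_matrix_field_def
  by (auto intro!: has_real_derivative_ray smooth_fun_differentiable)

lemma ray_derivative_scaleR: "ray_derivative E (t *\<^sub>R v) y = t *\<^sub>R ray_derivative E v y"
  by (simp add: ray_derivative_def vec_eq_iff sum_distrib_left mult_ac)

lemma continuous_ray_derivative:
  assumes "smooth_matrix_field E"
  shows "continuous_on UNIV (\<lambda>s. ray_derivative E x (s *\<^sub>R x) $ a $ m)"
  unfolding ray_derivative_def vec_lambda_beta
  using assms unfolding smooth_matrix_field_iff_Ck
  by (intro continuous_intros continuous_ray Ck_1D) auto

lemma continuous_smooth_ray:
  assumes "smooth_matrix_field E"
  shows "continuous_on UNIV (\<lambda>s. E (s *\<^sub>R x) $ a $ m)"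
  using assms unfolding smooth_matrix_field_iff_Ck by (intro continuous_ray Ck_1D) auto

text \<open>A radial condition evaluated at sx carries a factor s that cancels only for nonzero s;
  continuity recovers the value at the origin.\<close>

lemma continuous_const_off_zero:
  fixes f :: "real \<Rightarrow> real"
  assumes "continuous_on UNIV f" "\<And>s. s \<noteq> 0 \<Longrightarrow> f s = k"
  shows "f s = k"
proof (cases "s = 0")
  case True
  have "(f \<longlongrightarrow> f 0) (at 0)"
    using assms(1) by (simp add: continuous_on_eq_continuous_at isCont_def)
  moreover have "(f \<longlongrightarrow> k) (at 0)"
    by (rule tendsto_eventually) (auto simp: eventually_at_filter assms(2))
  ultimately show ?thesis using True tendsto_unique[of "at (0::real)"] by auto
qed (rule assms(2))

lemma radial_fixed_ray:
  assumes "smooth_matrix_field E" "\<And>x. E x *v x = x"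
  shows "E (s *\<^sub>R x) *v x = x"
proof -
  have "(E (s *\<^sub>R x) *v x) $ a = x $ a" for a
  proof (rule continuous_const_off_zero[where s = s])
    show "continuous_on UNIV (\<lambda>s. (E (s *\<^sub>R x) *v x) $ a)"
      unfolding matrix_vector_mult_def vec_lambda_beta
      by (intro continuous_intros continuous_smooth_ray assms)
    fix s :: real assume "s \<noteq> 0"
    have "s *\<^sub>R (E (s *\<^sub>R x) *v x) = s *\<^sub>R x"
      using assms(2)[of "s *\<^sub>R x"] by (simp add: matrix_vector_mult_scaleR)
    with \<open>s \<noteq> 0\<close> show "(E (s *\<^sub>R x) *v x) $ a = x $ a" by simp
  qed
  then show ?thesis by (simp add: vec_eq_iff)
qed

text \<open>Taking s = 0 on every ray shows that E at the origin fixes all vectors. This is where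
  the initial value of the radial equation comes from.\<close>

lemma radial_fixed_origin:
  assumes "smooth_matrix_field E" "\<And>x. E x *v x = x"
  shows "E 0 = mat 1"
  using radial_fixed_ray[OF assms, of 0] by (simp add: matrix_eq)

lemma matrix_add_rdistrib: "(B + C) ** A = B ** A + C ** (A :: real^'n^'n)"
  by (simp add: matrix_matrix_mult_def vec_eq_iff sum.distrib distrib_right)

lemma matrix_scaleR_left: "(k *\<^sub>R A) ** B = k *\<^sub>R (A ** (B :: real^'n^'n))"
  by (simp add: matrix_matrix_mult_def vec_eq_iff sum_distrib_left mult_ac)

lemma matrix_scaleR_right: "A ** (k *\<^sub>R B) = k *\<^sub>R (A ** (B :: real^'n^'n))"
  by (simp add: matrix_matrix_mult_def vec_eq_iff sum_distrib_left mult_ac)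

section \<open>The radial equation and the symmetry condition in matrix form\<close>

lemma radial_ode_solution_iff:
  assumes "smooth_matrix_field g"
  shows "radial_ode_solution g e \<longleftrightarrow> e 0 = mat 1 \<and>
    (\<forall>x t. has_matrix_derivative (\<lambda>s. e (s *\<^sub>R x))
       ((1/2) *\<^sub>R (transpose (matrix_inv (e (t *\<^sub>R x))) ** ray_derivative g x (t *\<^sub>R x))) t)"
proof -
  have "deriv (\<lambda>s. g (s *\<^sub>R x) $ n $ m) t = ray_derivative g x (t *\<^sub>R x) $ n $ m" for x t n m
    using has_matrix_derivative_ray[OF assms] unfolding has_matrix_derivative_def
    by (intro DERIV_imp_deriv) blast
  then show ?thesis
    unfolding radial_ode_solution_def has_matrix_derivative_def
    by (simp add: dual_frame_def mat_inverse_eq_matrix_inv matrix_matrix_mult_def transpose_def)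
qed

text \<open>The frame index of the coframe labels rows, so contraction with the dual frame is right
  multiplication by the inverse. The undifferentiated term of the Lie derivative contributes the
  identity.\<close>

lemma interior_lie_eq:
  assumes "vielbein e"
  shows "interior_lie e x a b = (ray_derivative e x x ** matrix_inv (e x)) $ b $ a + mat 1 $ b $ a"
proof -
  have inv: "invertible (e x)" and sm: "\<And>b m. (\<lambda>y. e y $ b $ m) differentiable (at x)"
    using assms smooth_fun_differentiable unfolding vielbein_def smooth_matrix_field_def by blast+
  have "frechet_derivative (\<lambda>y. e y $ b $ m) (at x) x = ray_derivative e x x $ b $ m" for m
    unfolding frechet_derivative_at[OF has_derivative_pd[OF sm[of b m]], symmetric]
    by (simp add: ray_derivative_def)
  then have "interior_lie e x a b = (ray_derivative e x x ** matrix_inv (e x)) $ b $ a + (e x ** matrix_inv (e x)) $ b $ a"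
    unfolding interior_lie_def lie_radial_def dual_frame_def mat_inverse_eq_matrix_inv matrix_matrix_mult_def
    by (simp add: algebra_simps sum.distrib)
  then show ?thesis by (simp add: matrix_inv_mult inv)
qed

text \<open>The identity contribution is symmetric and cancels.\<close>

lemma interior_lie_symmetric_iff:
  fixes e :: "real^'n \<Rightarrow> real^'n^'n"
  assumes "vielbein e"
  shows "(\<forall>a b. interior_lie e x a b = interior_lie e x b a) \<longleftrightarrow>
     transpose (ray_derivative e x x ** matrix_inv (e x)) = ray_derivative e x x ** matrix_inv (e x)"
proof -
  have "interior_lie e x a b = interior_lie e x b a \<longleftrightarrow>
      (ray_derivative e x x ** matrix_inv (e x)) $ b $ a = (ray_derivative e x x ** matrix_inv (e x)) $ a $ b" for a b
    unfolding interior_lie_eq[OF assms] by (simp add: mat_def)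
  then show ?thesis by (simp add: vec_eq_iff transpose_def)
qed

section \<open>Vielbeins and metrics in normal coordinates\<close>

lemma normal_metricD:
  fixes g :: "real^'n \<Rightarrow> real^'n^'n"
  assumes "normal_metric g"
  shows "smooth_matrix_field g" "transpose (g x) = g x" "invertible (g x)" "g x *v x = x" "g 0 = mat 1"
proof -
  show sm: "smooth_matrix_field g" and sym: "transpose (g x) = g x" for x
    using assms unfolding normal_metric_def riemannian_metric_def by auto
  have "v = 0" if "g x *v v = 0" for x v
    using assms that unfolding normal_metric_def riemannian_metric_def
    by (metis inner_zero_right less_irrefl)
  then show "invertible (g x)" for x
    by (meson invertible_left_inverse matrix_left_invertible_ker)
  have fixed: "g x *v x = x" for x
    using assms sym[of x] unfolding normal_metric_def by (metis transpose_matrix_vector)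
  then show "g x *v x = x" .
  show "g 0 = mat 1" by (rule radial_fixed_origin[OF sm fixed])
qed

section \<open>The linear form of the radial equation and uniqueness\<close>

lemma transpose_ray_derivative:
  assumes "\<And>x. transpose (g x) = g x"
  shows "transpose (ray_derivative g v y) = ray_derivative g v y"
proof -
  have "g z $ a $ m = g z $ m $ a" for z a m
    using arg_cong[OF assms[of z], of "\<lambda>A. A $ m $ a"] by (simp add: transpose_def)
  then show ?thesis by (simp add: ray_derivative_def transpose_def vec_eq_iff)
qed

text \<open>Differentiate the product of g and its inverse, which is constant.\<close>

lemma ray_derivative_matrix_inv:
  fixes g :: "real^'n \<Rightarrow> real^'n^'n"
  assumes sm: "smooth_matrix_field g" and inv: "\<And>x. invertible (g x)"
  shows "ray_derivative (\<lambda>y. matrix_inv (g y)) x (t *\<^sub>R x) =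
     - (matrix_inv (g (t *\<^sub>R x)) ** ray_derivative g x (t *\<^sub>R x) ** matrix_inv (g (t *\<^sub>R x)))"
proof -
  define h where "h = matrix_inv (g (t *\<^sub>R x))"
  define g' where "g' = ray_derivative g x (t *\<^sub>R x)"
  define h' where "h' = ray_derivative (\<lambda>y. matrix_inv (g y)) x (t *\<^sub>R x)"
  have "has_matrix_derivative (\<lambda>s. g (s *\<^sub>R x) ** matrix_inv (g (s *\<^sub>R x))) (g' ** h + g (t *\<^sub>R x) ** h') t"
    unfolding h_def g'_def h'_def
    by (intro has_matrix_derivative_mult has_matrix_derivative_ray sm smooth_matrix_inv inv
        has_matrix_derivative_ray[where E = "\<lambda>y. matrix_inv (g y)"])
  moreover have "has_matrix_derivative (\<lambda>s. g (s *\<^sub>R x) ** matrix_inv (g (s *\<^sub>R x))) 0 t"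
    by (simp add: matrix_inv_mult inv has_matrix_derivative_const)
  ultimately have "g' ** h + g (t *\<^sub>R x) ** h' = 0"
    by (rule has_matrix_derivative_unique)
  then have "h ** (g' ** h + g (t *\<^sub>R x) ** h') = h ** 0" by simp
  then have "h ** g' ** h + h' = 0"
    by (simp add: matrix_add_ldistrib matrix_mul_assoc h_def matrix_inv_mult inv)
  then show ?thesis
    unfolding h_def g'_def h'_def by (simp add: eq_neg_iff_add_eq_0 add.commute)
qed

text \<open>Coefficient N of the linear equation e' = e N. It would be half the derivative of log g
  if g commuted with its derivative.\<close>

definition half_log_derivative :: "(real^'n \<Rightarrow> real^'n^'n) \<Rightarrow> real^'n \<Rightarrow> real^'n \<Rightarrow> real^'n^'n" where
  "half_log_derivative g v y = (1/2) *\<^sub>R (matrix_inv (g y) ** ray_derivative g v y)"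

text \<open>With h the inverse of g, the derivative of e h f^T is e (N h + h' + h N^T) f^T. Here N h
  and h N^T both equal h g' h / 2, and h' is -h g' h, so the bracket vanishes.\<close>

lemma linear_solutions_product:
  fixes g e f :: "real^'n \<Rightarrow> real^'n^'n"
  assumes g: "normal_metric g" and e0: "e 0 = mat 1" and f0: "f 0 = mat 1"
    and e: "\<And>x t. has_matrix_derivative (\<lambda>s. e (s *\<^sub>R x)) (e (t *\<^sub>R x) ** half_log_derivative g x (t *\<^sub>R x)) t"
    and f: "\<And>x t. has_matrix_derivative (\<lambda>s. f (s *\<^sub>R x)) (f (t *\<^sub>R x) ** half_log_derivative g x (t *\<^sub>R x)) t"
  shows "e x ** matrix_inv (g x) ** transpose (f x) = mat 1"
proof -
  note g = normal_metricD[OF g]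
  have "has_matrix_derivative (\<lambda>s. e (s *\<^sub>R x) ** matrix_inv (g (s *\<^sub>R x)) ** transpose (f (s *\<^sub>R x))) 0 t" for t
  proof -
    define h where "h = matrix_inv (g (t *\<^sub>R x))"
    define g' where "g' = ray_derivative g x (t *\<^sub>R x)"
    define N where "N = half_log_derivative g x (t *\<^sub>R x)"
    have hT: "transpose h = h" by (simp add: h_def transpose_matrix_inv g)
    have g'T: "transpose g' = g'" unfolding g'_def by (rule transpose_ray_derivative[OF g(2)])
    have N: "N = (1/2) *\<^sub>R (h ** g')" by (simp add: N_def half_log_derivative_def h_def g'_def)
    have NT: "transpose N = (1/2) *\<^sub>R (g' ** h)"
      by (simp add: N transpose_scalar matrix_transpose_mul hT g'T)
    have cancel: "N ** h - h ** g' ** h + h ** transpose N = 0"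
      unfolding NT by (simp add: N matrix_scaleR_left matrix_scaleR_right matrix_mul_assoc scaleR_2[symmetric] flip: scaleR_left.add)
    have "has_matrix_derivative (\<lambda>s. e (s *\<^sub>R x) ** matrix_inv (g (s *\<^sub>R x)) ** transpose (f (s *\<^sub>R x)))
       ((e (t *\<^sub>R x) ** N ** h + e (t *\<^sub>R x) ** (- (h ** g' ** h))) ** transpose (f (t *\<^sub>R x))
         + e (t *\<^sub>R x) ** h ** transpose (f (t *\<^sub>R x) ** N)) t"
      unfolding h_def g'_def N_def ray_derivative_matrix_inv[OF g(1,3), symmetric]
      by (intro has_matrix_derivative_mult has_matrix_derivative_transpose e f
          has_matrix_derivative_ray[where E = "\<lambda>y. matrix_inv (g y)"] smooth_matrix_inv g)
    also have "(e (t *\<^sub>R x) ** N ** h + e (t *\<^sub>R x) ** (- (h ** g' ** h))) ** transpose (f (t *\<^sub>R x))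
         + e (t *\<^sub>R x) ** h ** transpose (f (t *\<^sub>R x) ** N)
        = e (t *\<^sub>R x) ** (N ** h - h ** g' ** h + h ** transpose N) ** transpose (f (t *\<^sub>R x))"
      unfolding diff_conv_add_uminus
      by (simp only: matrix_transpose_mul matrix_add_ldistrib matrix_add_rdistrib matrix_mul_assoc)
    finally show ?thesis by (simp add: cancel)
  qed
  \<comment> \<open>Constancy along the ray is read off between parameter 0, the origin, and
    parameter 1, the point x itself.\<close>
  from has_matrix_derivative_eq_imp_eq[where B = "\<lambda>s. mat 1" and t = 1, OF this has_matrix_derivative_const]
  show ?thesis by (simp add: e0 f0 g(5) matrix_inv_unique)
qed

text \<open>This identity exchanges the dual frame in the nonlinear equation for a factor e, making
  the equation linear.\<close>

lemma matrix_inv_metric_of: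
  fixes e :: "real^'n \<Rightarrow> real^'n^'n"
  assumes "invertible (e x)"
  shows "e x ** matrix_inv (metric_of e x) = transpose (matrix_inv (e x))"
proof -
  have "matrix_inv (metric_of e x) = matrix_inv (e x) ** transpose (matrix_inv (e x))"
  proof (rule matrix_inv_unique)
    have "metric_of e x ** (matrix_inv (e x) ** transpose (matrix_inv (e x)))
        = transpose (e x) ** (e x ** matrix_inv (e x)) ** transpose (matrix_inv (e x))"
      by (simp add: metric_of_def matrix_mul_assoc)
    also have "\<dots> = transpose (matrix_inv (e x) ** e x)"
      by (simp add: matrix_inv_mult assms flip: matrix_transpose_mul)
    finally show "metric_of e x ** (matrix_inv (e x) ** transpose (matrix_inv (e x))) = mat 1"
      by (simp add: matrix_inv_mult assms)
  qed
  then show ?thesis by (simp add: matrix_mul_assoc matrix_inv_mult assms)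
qed

text \<open>The equation makes e^T e' equal to g'/2; adding its transpose gives (e^T e)' = g', with
  equal values at the origin.\<close>

lemma radial_ode_imp_metric_of:
  fixes g e :: "real^'n \<Rightarrow> real^'n^'n"
  assumes g: "normal_metric g" and e: "vielbein e" and ode: "radial_ode_solution g e"
  shows "metric_of e = g"
proof
  fix x
  note g = normal_metricD[OF g]
  have inv: "invertible (e x)" for x using e vielbein_def by blast
  have ode: "e 0 = mat 1" "\<And>x t. has_matrix_derivative (\<lambda>s. e (s *\<^sub>R x))
       ((1/2) *\<^sub>R (transpose (matrix_inv (e (t *\<^sub>R x))) ** ray_derivative g x (t *\<^sub>R x))) t"
    using ode unfolding radial_ode_solution_iff[OF g(1)] by auto
  have "has_matrix_derivative (\<lambda>s. transpose (e (s *\<^sub>R x)) ** e (s *\<^sub>R x)) (ray_derivative g x (t *\<^sub>R x)) t" for t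
  proof -
    define E where "E = e (t *\<^sub>R x)"
    define g' where "g' = ray_derivative g x (t *\<^sub>R x)"
    have g'T: "transpose g' = g'" unfolding g'_def by (rule transpose_ray_derivative[OF g(2)])
    have E: "matrix_inv E ** E = mat 1" unfolding E_def by (rule matrix_inv_mult[OF inv])
    have ET: "transpose E ** transpose (matrix_inv E) = mat 1"
      using E by (simp add: matrix_transpose_mul[symmetric])
    have "has_matrix_derivative (\<lambda>s. transpose (e (s *\<^sub>R x)) ** e (s *\<^sub>R x))
       (transpose ((1/2) *\<^sub>R (transpose (matrix_inv E) ** g')) ** E + transpose E ** ((1/2) *\<^sub>R (transpose (matrix_inv E) ** g'))) t"
      unfolding E_def g'_def by (intro has_matrix_derivative_mult has_matrix_derivative_transpose ode)
    also have "transpose ((1/2) *\<^sub>R (transpose (matrix_inv E) ** g')) ** E = (1/2) *\<^sub>R g'"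
      by (simp add: transpose_scalar matrix_transpose_mul g'T matrix_scaleR_left matrix_mul_assoc[symmetric] E)
    also have "transpose E ** ((1/2) *\<^sub>R (transpose (matrix_inv E) ** g')) = (1/2) *\<^sub>R g'"
      by (simp add: matrix_scaleR_right matrix_mul_assoc ET)
    also have "(1/2) *\<^sub>R g' + (1/2) *\<^sub>R g' = g'"
      by (simp flip: scaleR_left.add)
    finally show ?thesis by (simp add: g'_def)
  qed
  from has_matrix_derivative_eq_imp_eq[OF this has_matrix_derivative_ray[OF g(1)], of 1]
  show "metric_of e x = g x" by (simp add: metric_of_def ode g(5))
qed

lemma radial_ode_imp_linear:
  fixes g e :: "real^'n \<Rightarrow> real^'n^'n"
  assumes g: "normal_metric g" and e: "vielbein e" and ode: "radial_ode_solution g e"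
  shows "e 0 = mat 1"
    "has_matrix_derivative (\<lambda>s. e (s *\<^sub>R x)) (e (t *\<^sub>R x) ** half_log_derivative g x (t *\<^sub>R x)) t"
proof -
  have inv: "invertible (e x)" for x using e vielbein_def by blast
  have "e y ** matrix_inv (g y) = transpose (matrix_inv (e y))" for y
    using matrix_inv_metric_of[of e y, OF inv] radial_ode_imp_metric_of[OF assms] by simp
  with ode show "e 0 = mat 1"
    "has_matrix_derivative (\<lambda>s. e (s *\<^sub>R x)) (e (t *\<^sub>R x) ** half_log_derivative g x (t *\<^sub>R x)) t"
    unfolding radial_ode_solution_iff[OF normal_metricD(1)[OF g]] half_log_derivative_def
    by (auto simp: matrix_scaleR_right matrix_mul_assoc)
qed

text \<open>In the constant product e g^-1 f^T = 1, the relation f^T f = g turns g^-1 f^T into f^-1,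
  leaving e f^-1 = 1.\<close>

lemma radial_ode_unique:
  fixes g e f :: "real^'n \<Rightarrow> real^'n^'n"
  assumes g: "normal_metric g"
    and e: "vielbein e" "radial_ode_solution g e" and f: "vielbein f" "radial_ode_solution g f"
  shows "e = f"
proof
  fix x
  have inv: "invertible (f x)" using f vielbein_def by blast
  have 1: "e x ** matrix_inv (g x) ** transpose (f x) = mat 1"
    by (rule linear_solutions_product[OF g]) (intro radial_ode_imp_linear[OF g] e f)+
  have "f x ** matrix_inv (g x) = transpose (matrix_inv (f x))"
    using matrix_inv_metric_of[of f x] inv radial_ode_imp_metric_of[OF g f] by simp
  then have "transpose (f x ** matrix_inv (g x)) = matrix_inv (f x)" by simp
  then have "matrix_inv (g x) ** transpose (f x) = matrix_inv (f x)"
    by (simp add: matrix_transpose_mul transpose_matrix_inv normal_metricD[OF g])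
  with 1 have "e x ** matrix_inv (f x) = mat 1" by (simp add: matrix_mul_assoc[symmetric])
  then have "e x ** matrix_inv (f x) ** f x = f x" by simp
  then show "e x = f x" by (simp add: matrix_mul_assoc[symmetric] matrix_inv_mult inv)
qed

section \<open>From vielbeins to metrics\<close>

lemma normal_vielbein_symmetric_ray:
  fixes e :: "real^'n \<Rightarrow> real^'n^'n"
  assumes "normal_vielbein e"
  defines "M \<equiv> \<lambda>x s. ray_derivative e x (s *\<^sub>R x) ** matrix_inv (e (s *\<^sub>R x))"
  shows "transpose (M x t) = M x t"
proof -
  have e: "vielbein e" and sm: "smooth_matrix_field e" and inv: "\<And>x. invertible (e x)"
    and lie: "\<And>x. \<forall>a b. interior_lie e x a b = interior_lie e x b a"
    using assms unfolding normal_vielbein_def vielbein_def by auto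
  have "M x t $ a $ b - M x t $ b $ a = 0" for a b
  proof (rule continuous_const_off_zero[where s = t])
    show "continuous_on UNIV (\<lambda>s. M x s $ a $ b - M x s $ b $ a)"
      unfolding M_def matrix_matrix_mult_def vec_lambda_beta
      by (intro continuous_intros continuous_ray_derivative sm
          continuous_smooth_ray[where E = "\<lambda>y. matrix_inv (e y)"] smooth_matrix_inv inv)
    fix s :: real assume s: "s \<noteq> 0"
    \<comment> \<open>The hypothesis at the point sx concerns the derivative in direction sx, hence
      s times \<open>M x s\<close>; nonzero s is cancelled, and s = 0 is covered by
      continuity.\<close>
    have "transpose (s *\<^sub>R M x s) = s *\<^sub>R M x s"
      using iffD1[OF interior_lie_symmetric_iff[OF e] lie, of "s *\<^sub>R x"]
      by (simp add: ray_derivative_scaleR M_def matrix_scaleR_left)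
    with s have "transpose (M x s) = M x s" by (simp add: transpose_scalar)
    from arg_cong[OF this, of "\<lambda>A. A $ a $ b"] show "M x s $ a $ b - M x s $ b $ a = 0"
      by (simp add: transpose_def)
  qed
  then show ?thesis by (simp add: vec_eq_iff transpose_def)
qed

text \<open>Symmetry of e' e^-1 turns e^-T e'^T e into e'. Both summands of e^-T (e^T e)' are
  therefore e', which accounts for the factor 1/2 in the equation.\<close>

lemma normal_vielbein_radial_ode:
  fixes e :: "real^'n \<Rightarrow> real^'n^'n"
  assumes "normal_vielbein e"
  shows "radial_ode_solution (metric_of e) e"
proof -
  have sm: "smooth_matrix_field e" and inv: "\<And>x. invertible (e x)" and fixed: "\<And>x. e x *v x = x"
    using assms unfolding normal_vielbein_def vielbein_def by auto
  have smg: "smooth_matrix_field (metric_of e)"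
    unfolding metric_of_def by (intro smooth_matrix_mult smooth_matrix_transpose sm)
  have "(1/2) *\<^sub>R (transpose (matrix_inv (e (t *\<^sub>R x))) ** ray_derivative (metric_of e) x (t *\<^sub>R x))
      = ray_derivative e x (t *\<^sub>R x)" for x t
  proof -
    define E where "E = e (t *\<^sub>R x)"
    define E' where "E' = ray_derivative e x (t *\<^sub>R x)"
    have E: "matrix_inv E ** E = mat 1" "E ** matrix_inv E = mat 1"
      unfolding E_def by (intro matrix_inv_mult inv)+
    then have ET: "transpose (matrix_inv E) ** transpose E = mat 1"
      by (simp add: matrix_transpose_mul[symmetric])
    have "has_matrix_derivative (\<lambda>s. transpose (e (s *\<^sub>R x)) ** e (s *\<^sub>R x)) (transpose E' ** E + transpose E ** E') t"
      unfolding E_def E'_def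
      by (intro has_matrix_derivative_mult has_matrix_derivative_transpose has_matrix_derivative_ray sm)
    then have g': "ray_derivative (metric_of e) x (t *\<^sub>R x) = transpose E' ** E + transpose E ** E'"
      using has_matrix_derivative_unique[OF has_matrix_derivative_ray[OF smg, of x t]] by (simp add: metric_of_def)
    have "transpose (E' ** matrix_inv E) = E' ** matrix_inv E"
      unfolding E_def E'_def by (rule normal_vielbein_symmetric_ray[OF assms])
    then have "transpose (matrix_inv E) ** transpose E' = E' ** matrix_inv E"
      by (simp add: matrix_transpose_mul)
    then have "transpose (matrix_inv E) ** (transpose E' ** E + transpose E ** E') = E' ** matrix_inv E ** E + E'"
      by (simp add: matrix_add_ldistrib matrix_mul_assoc ET)
    also have "\<dots> = 2 *\<^sub>R E'"
      by (simp add: matrix_mul_assoc[symmetric] E scaleR_2)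
    finally show ?thesis by (simp add: g' E_def[symmetric] E'_def[symmetric])
  qed
  then show ?thesis
    unfolding radial_ode_solution_iff[OF smg]
    using radial_fixed_origin[OF sm fixed] has_matrix_derivative_ray[OF sm] by simp
qed

text \<open>Invertibility of e gives definiteness. For the radial condition, x multiplied by e^T and
  then by e is fixed at each stage, by one of the two radial conditions on e.\<close>

lemma normal_vielbein_normal_metric:
  fixes e :: "real^'n \<Rightarrow> real^'n^'n"
  assumes "normal_vielbein e"
  shows "normal_metric (metric_of e)"
proof -
  have sm: "smooth_matrix_field e" and inv: "\<And>x. invertible (e x)" and fixed: "\<And>x. e x *v x = x"
    and fixed': "\<And>x. x v* e x = x"
    using assms unfolding normal_vielbein_def vielbein_def by auto
  have "v \<bullet> (metric_of e x *v v) > 0" if "v \<noteq> 0" for x v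
  proof -
    have "e x *v v \<noteq> 0"
    proof
      assume "e x *v v = 0"
      then have "matrix_inv (e x) *v (e x *v v) = 0" by simp
      then show False using that by (simp add: matrix_vector_mul_assoc matrix_inv_mult inv)
    qed
    moreover have "v \<bullet> (metric_of e x *v v) = (e x *v v) \<bullet> (e x *v v)"
      unfolding metric_of_def matrix_vector_mul_assoc[symmetric]
      by (simp add: dot_lmul_matrix inner_commute[of v])
    ultimately show ?thesis by simp
  qed
  moreover have "x v* metric_of e x = x" for x
    unfolding metric_of_def vector_matrix_mul_assoc[symmetric] by (simp add: fixed fixed')
  ultimately show ?thesis
    unfolding normal_metric_def riemannian_metric_def
    using smooth_matrix_mult[OF smooth_matrix_transpose[OF sm] sm]
    by (simp add: metric_of_def matrix_transpose_mul)
qed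

section \<open>From metrics to vielbeins\<close>

lemma normal_vielbein_exists:
  fixes g :: "real^'n \<Rightarrow> real^'n^'n"
  assumes "normal_metric g"
  obtains e where "normal_vielbein e" "metric_of e = g"
proof -
  note g = normal_metricD[OF assms]
  \<comment> \<open>The coefficient of dx^\<nu> in the matrix of 1-forms g^-1 dg / 2; contracting it
    with x gives \<open>half_log_derivative\<close>.\<close>
  define c where "c \<nu> p m = (\<lambda>y. (1/2) * (\<Sum>n\<in>UNIV. matrix_inv (g y) $ p $ n * pd \<nu> (\<lambda>z. g z $ n $ m) y))" for \<nu> p m
  have "Ck k (\<lambda>x. matrix_inv (g x) $ p $ n)" for k p n
    using smooth_matrix_inv[OF g(1,3)] unfolding smooth_matrix_field_iff_Ck by blast
  moreover have "Ck k (pd \<nu> (\<lambda>z. g z $ n $ m))" for k \<nu> n m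
    using g(1) unfolding smooth_matrix_field_def by (intro smooth_fun_imp_Ck smooth_fun_pd) blast
  ultimately have c: "smooth_fun (c \<nu> p m)" for \<nu> p m
    unfolding smooth_fun_iff_Ck c_def by (intro allI Ck_mult Ck_sum Ck_const)
  \<comment> \<open>The equation e' = e N only couples entries within a row of e, so each row is
    solved separately, starting from the corresponding row of the identity.\<close>
  define row where "row a u \<longleftrightarrow> (\<forall>m. smooth_fun (u m)) \<and> (\<forall>m. u m 0 = mat 1 $ a $ m) \<and>
      (\<forall>m x t. ((\<lambda>s. u m (s *\<^sub>R x)) has_real_derivative
       (\<Sum>\<nu>\<in>UNIV. \<Sum>p\<in>UNIV. x $ \<nu> * (u p (t *\<^sub>R x) * c \<nu> p m (t *\<^sub>R x)))) (at t))" for a :: 'n and u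
  have "\<exists>u. row a u" for a
    unfolding row_def by (rule radial_linear_ode_solution[of c "\<lambda>m. mat 1 $ a $ m", OF c]) blast
  then obtain u where "\<And>a. row a (u a)" by metis
  then have u: "\<And>a m. smooth_fun (u a m)" "\<And>a m. u a m 0 = mat 1 $ a $ m"
    "\<And>a m x t. ((\<lambda>s. u a m (s *\<^sub>R x)) has_real_derivative
       (\<Sum>\<nu>\<in>UNIV. \<Sum>p\<in>UNIV. x $ \<nu> * (u a p (t *\<^sub>R x) * c \<nu> p m (t *\<^sub>R x)))) (at t)"
    by (auto simp: row_def)
  define e where "e x = (\<chi> a m. u a m x)" for x
  have e0: "e 0 = mat 1" by (simp add: e_def u vec_eq_iff)
  have sm: "smooth_matrix_field e" by (simp add: smooth_matrix_field_def e_def u)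
  have N: "half_log_derivative g x y $ p $ m = (\<Sum>\<nu>\<in>UNIV. x $ \<nu> * c \<nu> p m y)" for x y p m
  proof -
    have "half_log_derivative g x y $ p $ m =
        (\<Sum>n\<in>UNIV. \<Sum>\<nu>\<in>UNIV. x $ \<nu> * (matrix_inv (g y) $ p $ n * pd \<nu> (\<lambda>z. g z $ n $ m) y) / 2)"
      by (simp add: half_log_derivative_def ray_derivative_def matrix_matrix_mult_def sum_distrib_left sum_divide_distrib mult_ac)
    also have "\<dots> = (\<Sum>\<nu>\<in>UNIV. \<Sum>n\<in>UNIV. x $ \<nu> * (matrix_inv (g y) $ p $ n * pd \<nu> (\<lambda>z. g z $ n $ m) y) / 2)"
      by (rule sum.swap)
    also have "\<dots> = (\<Sum>\<nu>\<in>UNIV. x $ \<nu> * c \<nu> p m y)"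
      by (simp add: c_def sum_distrib_left sum_divide_distrib)
    finally show ?thesis .
  qed
  have e': "has_matrix_derivative (\<lambda>s. e (s *\<^sub>R x)) (e (t *\<^sub>R x) ** half_log_derivative g x (t *\<^sub>R x)) t" for x t
  proof -
    have "(\<Sum>\<nu>\<in>UNIV. \<Sum>p\<in>UNIV. x $ \<nu> * (u a p (t *\<^sub>R x) * c \<nu> p m (t *\<^sub>R x)))
        = (e (t *\<^sub>R x) ** half_log_derivative g x (t *\<^sub>R x)) $ a $ m" for a m
      unfolding matrix_matrix_mult_def vec_lambda_beta N e_def
      by (subst sum.swap) (simp add: sum_distrib_left mult_ac)
    with u(3)[of _ _ x t] show ?thesis
      unfolding has_matrix_derivative_def by (simp add: e_def)
  qed
  \<comment> \<open>Both solutions are taken to be e. The identity shows that e is invertible and,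
    after cyclic rearrangement of the factors, that e^T e = g.\<close>
  have prod: "e x ** matrix_inv (g x) ** transpose (e x) = mat 1" for x
    by (rule linear_solutions_product[OF assms e0 e0 e' e'])
  have inv: "invertible (e x)" for x
    using prod[of x] by (metis invertible_right_inverse matrix_mul_assoc)
  have metric: "metric_of e = g"
  proof
    fix x
    have "e x ** (matrix_inv (g x) ** transpose (e x)) = mat 1"
      using prod[of x] by (simp add: matrix_mul_assoc)
    then have "matrix_inv (g x) ** transpose (e x) ** e x = mat 1"
      using matrix_left_right_inverse by blast
    then have "g x ** (matrix_inv (g x) ** transpose (e x) ** e x) = g x" by simp
    then show "metric_of e x = g x"
      by (simp add: metric_of_def matrix_mul_assoc matrix_inv_mult g)
  qed
  have e_fixed: "e x *v x = x" for x
  proof -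
    \<comment> \<open>Along the ray g(sx) x is the constant x, so its derivative in s vanishes.
      Hence N x = 0, and e(sx) x keeps its initial value x.\<close>
    have g'x: "ray_derivative g x (t *\<^sub>R x) *v x = 0" for t
    proof -
      have "((\<lambda>s. (g (s *\<^sub>R x) *v x) $ a) has_real_derivative (ray_derivative g x (t *\<^sub>R x) *v x) $ a) (at t)" for a
        by (rule has_matrix_derivative_vector[OF has_matrix_derivative_ray[OF g(1)]])
      then have "((\<lambda>s. x $ a) has_real_derivative (ray_derivative g x (t *\<^sub>R x) *v x) $ a) (at t)" for a
        by (simp add: radial_fixed_ray[OF g(1,4)])
      then have "(ray_derivative g x (t *\<^sub>R x) *v x) $ a = 0" for a
        using DERIV_unique DERIV_const by blast
      then show ?thesis by (simp add: vec_eq_iff)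
    qed
    have "(e (1 *\<^sub>R x) *v x) $ a = x $ a" for a
    proof (rule real_derivative_eq_imp_eq[where D = "\<lambda>t. 0" and f = "\<lambda>s. (e (s *\<^sub>R x) *v x) $ a"
          and g = "\<lambda>s. x $ a" and t = 1])
      have "(e (t *\<^sub>R x) ** half_log_derivative g x (t *\<^sub>R x)) *v x = 0" for t
        by (simp add: half_log_derivative_def matrix_vector_mul_assoc[symmetric] scaleR_matrix_vector_assoc[symmetric] g'x)
      then show "((\<lambda>s. (e (s *\<^sub>R x) *v x) $ a) has_real_derivative 0) (at t)" for t
        using has_matrix_derivative_vector[OF e'[of x t], of x a] by simp
    qed (auto simp: e0)
    then show ?thesis by (simp add: vec_eq_iff)
  qed
  have "x v* e x = x" for x
  proof -
    \<comment> \<open>Replacing x by e x turns the left action of x into that of g, which fixes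
      x.\<close>
    have "x v* e x = (e x *v x) v* e x" by (simp add: e_fixed)
    also have "\<dots> = metric_of e x *v x"
      by (simp add: metric_of_def matrix_vector_mul_assoc[symmetric])
    also have "\<dots> = x" by (simp add: metric g)
    finally show ?thesis .
  qed
  moreover have viel: "vielbein e" using sm inv by (simp add: vielbein_def)
  moreover have "\<forall>a b. interior_lie e x a b = interior_lie e x b a" for x
  proof -
    have g'T: "transpose (ray_derivative g x x) = ray_derivative g x x"
      by (rule transpose_ray_derivative[OF g(2)])
    have "ray_derivative e x x = e x ** half_log_derivative g x x"
      using has_matrix_derivative_unique[OF has_matrix_derivative_ray[OF sm] e', of x 1] by simp
    \<comment> \<open>Rewriting e g^-1 as e^-T makes e' e^-1 a congruence transform of the symmetric
      matrix g', hence symmetric.\<close>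
    also have "\<dots> = (1/2) *\<^sub>R (transpose (matrix_inv (e x)) ** ray_derivative g x x)"
      using matrix_inv_metric_of[of e x, OF inv] by (simp add: metric half_log_derivative_def matrix_scaleR_right matrix_mul_assoc)
    finally have "ray_derivative e x x ** matrix_inv (e x)
        = (1/2) *\<^sub>R (transpose (matrix_inv (e x)) ** ray_derivative g x x ** matrix_inv (e x))"
      by (simp add: matrix_scaleR_left)
    then show ?thesis
      unfolding interior_lie_symmetric_iff[OF viel]
      by (simp add: transpose_scalar matrix_transpose_mul g'T matrix_mul_assoc)
  qed
  ultimately have "normal_vielbein e"
    unfolding normal_vielbein_def using e_fixed by blast
  with metric show thesis by (rule that[rotated])
qed

text \<open>A normal vielbein solves the radial equation of its own metric, and that equation has at
  most one vielbein solution. This yields injectivity and identifies \<open>inv_into\<close> as the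
  solution map; surjectivity is the existence lemma.\<close>

theorem theorem3:
  fixes dummy :: "'n::finite itself"
  shows "bij_betw (metric_of :: (real^'n \<Rightarrow> real^'n^'n) \<Rightarrow> _)
           {e. normal_vielbein e} {g. normal_metric g}
       \<and> (\<forall>g::real^'n \<Rightarrow> real^'n^'n. normal_metric g \<longrightarrow>
            radial_ode_solution g (inv_into {e. normal_vielbein e} metric_of g)
          \<and> (\<forall>e. vielbein e \<and> radial_ode_solution g e
                 \<longrightarrow> e = inv_into {e. normal_vielbein e} metric_of g))"
proof -
  let ?V = "{e :: real^'n \<Rightarrow> real^'n^'n. normal_vielbein e}"
  have vielbein: "vielbein e" if "normal_vielbein e" for e :: "real^'n \<Rightarrow> real^'n^'n"
    using that normal_vielbein_def by blast
  have "inj_on metric_of ?V"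
  proof (rule inj_onI)
    fix e f :: "real^'n \<Rightarrow> real^'n^'n"
    assume "e \<in> ?V" "f \<in> ?V" and eq: "metric_of e = metric_of f"
    then have nv: "normal_vielbein e" "normal_vielbein f" by auto
    \<comment> \<open>Two normal vielbeins with a common metric solve the same radial
      equation.\<close>
    from radial_ode_unique[OF normal_vielbein_normal_metric[OF nv(2)] vielbein[OF nv(1)] _ vielbein[OF nv(2)]]
    show "e = f"
      using normal_vielbein_radial_ode[OF nv(1)] normal_vielbein_radial_ode[OF nv(2)] eq by simp
  qed
  moreover have image: "metric_of ` ?V = {g. normal_metric g}"
  proof (intro equalityI subsetI)
    fix g :: "real^'n \<Rightarrow> real^'n^'n"
    assume "g \<in> {g. normal_metric g}"
    then have "normal_metric g" by simp
    then obtain e where "normal_vielbein e" "metric_of e = g" by (rule normal_vielbein_exists)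
    then show "g \<in> metric_of ` ?V" by blast
  qed (use normal_vielbein_normal_metric in auto)
  ultimately have bij: "bij_betw metric_of ?V {g. normal_metric g}"
    by (simp add: bij_betw_def)
  have "radial_ode_solution g (inv_into ?V metric_of g) \<and>
      (\<forall>e. vielbein e \<and> radial_ode_solution g e \<longrightarrow> e = inv_into ?V metric_of g)"
    if g: "normal_metric g" for g
  proof -
    have gV: "g \<in> metric_of ` ?V" using g image by blast
    have nv: "normal_vielbein (inv_into ?V metric_of g)" using inv_into_into[OF gV] by blast
    have "radial_ode_solution g (inv_into ?V metric_of g)"
      using normal_vielbein_radial_ode[OF nv] f_inv_into_f[OF gV] by simp
    with radial_ode_unique[OF g _ _ vielbein[OF nv]] show ?thesis by blast
  qed
  with bij show ?thesis by blast
qed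

end
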